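(* Let $p>2$ be a prime, let $m\ge 1$ be an integer, and let $F$ be an infinite field of characteristic $0$ or $p$. Then the $\mathbb{Z}_2$-graded Gelfand-Kirillov dimension of $E_\infty$ in $m$ variables over $F$ is $$\mathrm{GKdim}_m^{\mathbb{Z}_2}(E_\infty)=2m\quad\text{if the characteristic of }F\text{ is }0,$$ $$\mathrm{GKdim}_m^{\mathbb{Z}_2}(E_\infty)=m\quad\text{if the characteristic of }F\text{ is }p.$$
   Context: All algebras are associative and unitary. $E$ is the infinite dimensional unitary Grassmann algebra over $F$, generated by $e_1,e_2,\dots$ with relations $e_ie_j+e_je_i=0$ for all $i,j$; it has basis $\{e_{i_1}\cdots e_{i_n}\mid n\ge 0,\ i_1<\cdots<i_n\}$. $E_\infty$ denotes $E$ with the $\mathbb{Z}_2$-grading induced by $\deg(e_i)=1$ for $i$ odd and $\deg(e_i)=0$ for $i$ even (a monomial has degree the sum of the degrees of its factors). For a $\mathbb{Z}_2$-graded algebra $B=B^0\oplus B^1$, $T_{\mathbb{Z}_2}(B)$ is the ideal of $\mathbb{Z}_2$-graded polynomial identities of $B$, i.e. the polynomials in the free associative algebra on variables $y_i$ (degree $0$) and $z_i$ (degree $1$) vanishing whenever the $y_i$ are replaced by arbitrary elements of $B^0$ and the $z_i$ by arbitrary elements of $B^1$. The relatively-free $\mathbb{Z}_2$-graded algebra in $m$ variables is $$F_m^{\mathbb{Z}_2}(B)=F\langle y_1,\dots,y_m,z_1,\dots,z_m\rangle/\big(F\langle y_1,\dots,y_m,z_1,\dots,z_m\rangle\cap T_{\mathbb{Z}_2}(B)\big),$$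 and $\mathrm{GKdim}_m^{\mathbb{Z}_2}(B):=\mathrm{GKdim}(F_m^{\mathbb{Z}_2}(B))$ is its Gelfand-Kirillov dimension. *)

theory Defs
  imports
    "HOL-Library.Poly_Mapping"
    "HOL-Library.Z2"
    "HOL-Library.Extended_Real"
    "HOL-Library.Liminf_Limsup"
    "HOL-Algebra.Algebraic_Closure_Type"
    "HOL-Algebra.Embedded_Algebras"
    "HOL-Algebra.QuotRing"
begin

section \<open>Free associative algebras\<close>

text \<open>
  The free algebra on the variables \<open>'v\<close> over \<open>'a\<close> is the monoid algebra of the free
  monoid of words. The convolution product of \<open>Poly_Mapping\<close> expects the monoid in
  additive notation, so below \<open>+\<close> on words is concatenation and \<open>0\<close> is the empty word.
\<close>

datatype 'v word = Word (letters: "'v list")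

instantiation word :: (type) monoid_add
begin
definition "0 = Word []"
definition "u + v = Word (letters u @ letters v)"
instance by standard (auto simp: zero_word_def plus_word_def)
end

type_synonym ('v, 'a) free_algebra = "'v word \<Rightarrow>\<^sub>0 'a"

definition fa_var :: "'v \<Rightarrow> ('v, 'a::field) free_algebra"
  where "fa_var v = Poly_Mapping.single (Word [v]) 1"

definition fa_const :: "'a \<Rightarrow> ('v, 'a::field) free_algebra"
  where "fa_const c = Poly_Mapping.single 0 c"

definition fa_eval :: "('a \<Rightarrow> 'b \<Rightarrow> 'b) \<Rightarrow> ('v \<Rightarrow> 'b) \<Rightarrow> ('v, 'a::field) free_algebra \<Rightarrow> 'b::ring_1"
  where "fa_eval scale \<phi> f =
    (\<Sum>w\<in>Poly_Mapping.keys f. scale (Poly_Mapping.lookup f w) (prod_list (map \<phi> (letters w))))"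

text \<open>The library proves this only for commutative type classes.\<close>

lemma ring_of_type_algebra_ring: "ring (ring_of_type_algebra :: 'b::ring_1 ring)"
proof -
  have "\<exists>y. x + y = 0" for x :: 'b
    using add.right_inverse by blast
  thus ?thesis
    unfolding ring_of_type_algebra_def using add.right_inverse
    by unfold_locales (auto simp: algebra_simps Units_def)
qed


section \<open>The Grassmann algebra\<close>

text \<open>The variable \<open>k :: nat\<close> stands for the generator $e_{k+1}$.\<close>

definition grassmann_relators :: "(nat, 'a::field) free_algebra set"
  where "grassmann_relators = {fa_var i * fa_var j + fa_var j * fa_var i | i j. True}"

definition grassmann_ideal :: "(nat, 'a::field) free_algebra set"
  where "grassmann_ideal = Idl\<^bsub>ring_of_type_algebra\<^esub> grassmann_relators"

lemma word_add_eq_0_iff: "0 = u + v \<longleftrightarrow> u = 0 \<and> v = (0 :: 'v word)"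
  by (cases u; cases v) (auto simp: zero_word_def plus_word_def)

lemma lookup_mult_0:
  fixes f g :: "('v, 'a::field) free_algebra"
  shows "Poly_Mapping.lookup (f * g) 0 = Poly_Mapping.lookup f 0 * Poly_Mapping.lookup g 0"
proof -
  have "(\<Sum>q. Poly_Mapping.lookup g q when (0 = l + q)) = (Poly_Mapping.lookup g 0 when l = 0)" for l
    by (cases "l = 0") (simp_all add: word_add_eq_0_iff)
  then show ?thesis
    by (simp add: lookup_mult mult_when)
qed

lemma grassmann_ideal_is_ideal:
  "ideal (grassmann_ideal :: (nat, 'a::field) free_algebra set) ring_of_type_algebra"
  unfolding grassmann_ideal_def
  by (rule ring.genideal_ideal[OF ring_of_type_algebra_ring]) (simp add: ring_of_type_algebra_def)

lemma grassmann_ideal_0: "0 \<in> grassmann_ideal"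
  using additive_subgroup.zero_closed[OF ideal.axioms(1)[OF grassmann_ideal_is_ideal]]
  by (simp add: ring_of_type_algebra_def)

lemma grassmann_ideal_add: "x \<in> grassmann_ideal \<Longrightarrow> y \<in> grassmann_ideal \<Longrightarrow> x + y \<in> grassmann_ideal"
  using additive_subgroup.a_closed[OF ideal.axioms(1)[OF grassmann_ideal_is_ideal], of x y]
  by (simp add: ring_of_type_algebra_def)

lemma grassmann_ideal_mult_left: "x \<in> grassmann_ideal \<Longrightarrow> r * x \<in> grassmann_ideal"
  using ideal.I_l_closed[OF grassmann_ideal_is_ideal, of x r]
  by (simp add: ring_of_type_algebra_def)

lemma grassmann_ideal_mult_right: "x \<in> grassmann_ideal \<Longrightarrow> x * r \<in> grassmann_ideal"
  using ideal.I_r_closed[OF grassmann_ideal_is_ideal, of x r]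
  by (simp add: ring_of_type_algebra_def)

lemma grassmann_ideal_uminus: "x \<in> grassmann_ideal \<Longrightarrow> - x \<in> grassmann_ideal"
  using grassmann_ideal_mult_left[of x "-1"] by simp

lemma one_notin_grassmann_ideal: "1 \<notin> (grassmann_ideal :: (nat, 'a::field) free_algebra set)"
proof -
  let ?I = "{f :: (nat, 'a) free_algebra. Poly_Mapping.lookup f 0 = 0}"
  have "ideal ?I ring_of_type_algebra"
  proof (rule idealI[OF ring_of_type_algebra_ring])
    show "subgroup ?I (add_monoid ring_of_type_algebra)"
    proof (rule group.subgroupI)
      show "group (add_monoid (ring_of_type_algebra :: (nat, 'a) free_algebra ring))"
        using ring_of_type_algebra_ring by (rule abelian_group.a_group[OF ring.is_abelian_group])
      fix a :: "(nat, 'a) free_algebra" assume a: "a \<in> ?I"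
      have "inv\<^bsub>add_monoid ring_of_type_algebra\<^esub> a = - a"
        by (rule group.inv_equality[OF \<open>group _\<close>]) (simp_all add: ring_of_type_algebra_def)
      with a show "inv\<^bsub>add_monoid ring_of_type_algebra\<^esub> a \<in> ?I" by simp
    qed (auto simp: ring_of_type_algebra_def lookup_add intro: exI[of _ 0])
  qed (auto simp: ring_of_type_algebra_def lookup_mult_0)
  moreover have "grassmann_relators \<subseteq> ?I"
    by (auto simp: grassmann_relators_def fa_var_def lookup_add lookup_single mult_single
        when_def zero_word_def plus_word_def)
  ultimately have "grassmann_ideal \<subseteq> ?I"
    unfolding grassmann_ideal_def by (rule ring.genideal_minimal[OF ring_of_type_algebra_ring])
  then show ?thesis by (auto simp: lookup_one)
qed

definition grassmann_rel :: "(nat, 'a::field) free_algebra \<Rightarrow> (nat, 'a) free_algebra \<Rightarrow> bool"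
  where "grassmann_rel f g \<longleftrightarrow> f - g \<in> grassmann_ideal"

lemma equivp_grassmann_rel: "equivp grassmann_rel"
proof (rule equivpI)
  show "reflp grassmann_rel"
    by (simp add: reflp_def grassmann_rel_def grassmann_ideal_0)
  show "symp grassmann_rel"
    using grassmann_ideal_uminus by (fastforce simp: symp_def grassmann_rel_def)
  show "transp grassmann_rel"
    using grassmann_ideal_add by (fastforce simp: transp_def grassmann_rel_def)
qed

quotient_type (overloaded) 'a grassmann = "(nat, 'a::field) free_algebra" / grassmann_rel
  by (rule equivp_grassmann_rel)

instantiation grassmann :: (field) ring_1
begin

lift_definition zero_grassmann :: "'a grassmann" is 0 .
lift_definition one_grassmann :: "'a grassmann" is 1 .

lift_definition plus_grassmann :: "'a grassmann \<Rightarrow> 'a grassmann \<Rightarrow> 'a grassmann" is "(+)"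
  using grassmann_ideal_add by (fastforce simp: grassmann_rel_def add_diff_add)

lift_definition uminus_grassmann :: "'a grassmann \<Rightarrow> 'a grassmann" is uminus
  using grassmann_ideal_uminus by (fastforce simp: grassmann_rel_def)

lift_definition minus_grassmann :: "'a grassmann \<Rightarrow> 'a grassmann \<Rightarrow> 'a grassmann" is "(-)"
proof -
  fix a b c d :: "(nat, 'a) free_algebra"
  assume "grassmann_rel a b" "grassmann_rel c d"
  then have "(a - b) + - (c - d) \<in> grassmann_ideal"
    unfolding grassmann_rel_def by (intro grassmann_ideal_add grassmann_ideal_uminus)
  then show "grassmann_rel (a - c) (b - d)"
    by (simp add: grassmann_rel_def algebra_simps)
qed

lift_definition times_grassmann :: "'a grassmann \<Rightarrow> 'a grassmann \<Rightarrow> 'a grassmann" is "(*)"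
proof -
  fix a b c d :: "(nat, 'a) free_algebra"
  assume "grassmann_rel a b" "grassmann_rel c d"
  then have "(a - b) * c + b * (c - d) \<in> grassmann_ideal"
    unfolding grassmann_rel_def
    by (intro grassmann_ideal_add grassmann_ideal_mult_left grassmann_ideal_mult_right)
  then show "grassmann_rel (a * c) (b * d)"
    by (simp add: grassmann_rel_def algebra_simps)
qed

instance
proof
  have "- 1 \<notin> (grassmann_ideal :: (nat, 'a) free_algebra set)"
    using grassmann_ideal_uminus[of "- 1 :: (nat, 'a) free_algebra"] one_notin_grassmann_ideal
    by auto
  then show "(0 :: 'a grassmann) \<noteq> 1"
    unfolding zero_grassmann_def one_grassmann_def grassmann.abs_eq_iff
    by (simp add: grassmann_rel_def)
qed (transfer; simp add: algebra_simps grassmann_rel_def grassmann_ideal_0)+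

end

lift_definition grassmann_scale :: "'a \<Rightarrow> 'a grassmann \<Rightarrow> 'a::field grassmann"
  is "\<lambda>c f. fa_const c * f"
  using grassmann_ideal_mult_left by (fastforce simp: grassmann_rel_def right_diff_distrib[symmetric])

global_interpretation grassmann: vector_space "grassmann_scale :: 'a::field \<Rightarrow> _"
proof
  fix a b :: 'a and x y :: "'a grassmann"
  show "grassmann_scale a (x + y) = grassmann_scale a x + grassmann_scale a y"
    by transfer (simp add: algebra_simps grassmann_rel_def grassmann_ideal_0)
  show "grassmann_scale (a + b) x = grassmann_scale a x + grassmann_scale b x"
    by transfer
      (simp add: algebra_simps grassmann_rel_def grassmann_ideal_0 fa_const_def single_add)
  show "grassmann_scale a (grassmann_scale b x) = grassmann_scale (a * b) x"
    by transfer
      (simp add: mult.assoc[symmetric] mult_single grassmann_rel_def grassmann_ideal_0 fa_const_def)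
  show "grassmann_scale 1 x = x"
    by transfer (simp add: grassmann_rel_def grassmann_ideal_0 fa_const_def)
qed

lift_definition grassmann_monomial :: "nat word \<Rightarrow> 'a::field grassmann"
  is "\<lambda>w. Poly_Mapping.single w 1" .

text \<open>
  In $E_\infty$ the generator $e_i$ has degree 1 for odd \<open>i\<close> and degree 0 for even \<open>i\<close>;
  recall that the letter \<open>k\<close> is $e_{k+1}$.
\<close>

definition E_inf_degree :: "nat word \<Rightarrow> bit"
  where "E_inf_degree w = (\<Sum>k\<leftarrow>letters w. if odd (Suc k) then 1 else 0)"

definition E_inf_component :: "bit \<Rightarrow> 'a::field grassmann set"
  where "E_inf_component d = grassmann.span {grassmann_monomial w | w. E_inf_degree w = d}"


section \<open>Graded identities and relatively free algebras\<close>

datatype graded_var = Y nat | Z nat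

text \<open>
  A $\mathbb{Z}_2$-graded algebra is given by a ring type \<open>'b\<close>, its scalar multiplication
  and its homogeneous components \<open>B 0\<close> and \<open>B 1\<close>.
\<close>

definition graded_identities ::
    "('a::field \<Rightarrow> 'b \<Rightarrow> 'b) \<Rightarrow> (bit \<Rightarrow> 'b::ring_1 set) \<Rightarrow> (graded_var, 'a) free_algebra set"
  where "graded_identities scale B =
    {f. \<forall>\<phi>. (\<forall>i. \<phi> (Y i) \<in> B 0 \<and> \<phi> (Z i) \<in> B 1) \<longrightarrow> fa_eval scale \<phi> f = 0}"

definition free_graded_algebra :: "nat \<Rightarrow> (graded_var, 'a::field) free_algebra ring"
  where "free_graded_algebra m = ring_of_type_algebra
    \<lparr>carrier := {f. \<forall>w\<in>Poly_Mapping.keys f. set (letters w) \<subseteq> Y ` {1..m} \<union> Z ` {1..m}}\<rparr>"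

definition relfree_ideal ::
    "('a::field \<Rightarrow> 'b \<Rightarrow> 'b) \<Rightarrow> (bit \<Rightarrow> 'b::ring_1 set) \<Rightarrow> nat \<Rightarrow> (graded_var, 'a) free_algebra set"
  where "relfree_ideal scale B m =
    carrier (free_graded_algebra m) \<inter> graded_identities scale B"

definition relfree_algebra ::
    "('a::field \<Rightarrow> 'b \<Rightarrow> 'b) \<Rightarrow> (bit \<Rightarrow> 'b::ring_1 set) \<Rightarrow> nat \<Rightarrow> (graded_var, 'a) free_algebra set ring"
  where "relfree_algebra scale B m = free_graded_algebra m Quot relfree_ideal scale B m"

text \<open>The base field, embedded in the relatively free algebra as the scalar multiples of 1.\<close>

definition relfree_scalars ::
    "('a::field \<Rightarrow> 'b \<Rightarrow> 'b) \<Rightarrow> (bit \<Rightarrow> 'b::ring_1 set) \<Rightarrow> nat \<Rightarrow> (graded_var, 'a) free_algebra set set"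
  where "relfree_scalars scale B m =
    range (\<lambda>c. relfree_ideal scale B m +>\<^bsub>free_graded_algebra m\<^esub> fa_const c)"


section \<open>Gelfand--Kirillov dimension\<close>

text \<open>
  An algebra over a field is a ring \<open>A\<close> with a central subfield \<open>K\<close>, as in
  \<open>HOL-Algebra.Embedded_Algebras\<close>, where the locale \<open>subalgebra K V A\<close> says, despite its
  name, just that \<open>V\<close> is a \<open>K\<close>-subspace of \<open>A\<close>.
\<close>

definition subspace_hull :: "'r set \<Rightarrow> ('r, 's) ring_scheme \<Rightarrow> 'r set \<Rightarrow> 'r set"
  where "subspace_hull K A S = \<Inter>{W. subalgebra K W A \<and> S \<subseteq> W}"

text \<open>$V^0 + V^1 + \dots + V^n$, where $V^i$ is spanned by the products of \<open>i\<close> elements of \<open>V\<close>.\<close>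

definition power_sum :: "'r set \<Rightarrow> ('r, 's) ring_scheme \<Rightarrow> 'r set \<Rightarrow> nat \<Rightarrow> 'r set"
  where "power_sum K A V n =
    subspace_hull K A {foldr (\<otimes>\<^bsub>A\<^esub>) vs \<one>\<^bsub>A\<^esub> | vs. set vs \<subseteq> V \<and> length vs \<le> n}"

definition GKdim :: "'r set \<Rightarrow> ('r, 's) ring_scheme \<Rightarrow> ereal"
  where "GKdim K A = (SUP V\<in>{V. subalgebra K V A \<and> ring.finite_dimension A K V}.
    limsup (\<lambda>n. ereal (log (real n) (real (ring.dim A K (power_sum K A V n))))))"

definition graded_GKdim ::
    "('a::field \<Rightarrow> 'b \<Rightarrow> 'b) \<Rightarrow> (bit \<Rightarrow> 'b::ring_1 set) \<Rightarrow> nat \<Rightarrow> ereal"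
  where "graded_GKdim scale B m = GKdim (relfree_scalars scale B m) (relfree_algebra scale B m)"

end

theory Submission
  imports Defs "HOL-Library.Function_Algebras" "HOL-Real_Asymp.Real_Asymp"
begin

text \<open>
  The relatively free algebra embeds into the algebra of functions from homogeneous substitutions
  to \<open>E\<close>: a polynomial becomes the function that evaluates it, and the graded identities are
  exactly the kernel. The variable \<open>v\<close> becomes the generic homogeneous element
  \<open>x\<^sub>v = a\<^sub>v + b\<^sub>v\<close>, where \<open>a\<^sub>v\<close> collects the monomials of even length and \<open>b\<^sub>v\<close> those of odd length.
  The \<open>a\<^sub>v\<close> are central, and the \<open>b\<^sub>v\<close> anticommute and square to zero.

  Upper bound. A word of length at most \<open>n\<close> in the \<open>x\<^sub>v\<close> is a combination of products of powers
  of the \<open>a\<^sub>v\<close> with exponents at most \<open>n\<close> and of a product of distinct \<open>b\<^sub>v\<close>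
  (\<open>span_words_supercommuting\<close>). There are boundedly many products of the second kind, so with \<open>2 m\<close>
  variables this gives \<open>O(n\<^bsup>2m\<^esup>)\<close> products. In characteristic \<open>p\<close>, if \<open>v\<close> has degree 1 then \<open>a\<^sub>v\<close> has
  no constant term, hence is a sum of commuting monomials of square zero, and its \<open>p\<close>-th power
  is 0 (\<open>even_part_nilpotent\<close>). The exponents of the \<open>z\<close>-variables are then bounded, and
  \<open>O(n\<^sup>m)\<close> products remain.

  Lower bound. It is enough that the ordered monomials with exponents at most \<open>N\<close>, in all
  variables or only in the \<open>y\<^sub>i\<close>, are linearly independent modulo the identities, for every \<open>N\<close>.
  Substitute scalar multiples \<open>s\<^bsup>k\<^esup> u\<^sub>v\<close> for the variables, where the weights \<open>k\<close> separate the exponent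
  vectors; since the field is infinite, the powers of \<open>s\<close> separate the terms of an identity
  (\<open>independent_power_words\<close>), and only the product of the \<open>u\<^sub>v\<^bsup>N\<^esup>\<close> has to be nonzero. For the
  \<open>y\<^sub>i\<close> take \<open>u\<^sub>v = 1\<close>. For the \<open>z\<^sub>i\<close> in characteristic 0 take sums of \<open>N\<close> products
  \<open>e\<^sub>j e\<^sub>j\<^sub>+\<^sub>1\<close> with \<open>j\<close> odd, using different generators for different \<open>i\<close>: the \<open>N\<close>-th power of such a
  sum is \<open>N!\<close> times the product of its terms, so the product of all these powers is a nonzero
  multiple of a monomial without repeated generators. Such a monomial is not 0 in \<open>E\<close>, by a linear
  functional that reads off the sign of a permutation (\<open>grassmann_monomial_distinct\<close>).
\<close>

section \<open>Algebras over a field and evaluation of noncommutative polynomials\<close>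

lemma free_algebra_induct [case_names single add]:
  fixes f :: "('v, 'a::field) free_algebra"
  assumes "\<And>w c. P (Poly_Mapping.single w c)" and "\<And>f g. P f \<Longrightarrow> P g \<Longrightarrow> P (f + g)"
  shows "P f"
proof (induction f rule: update_induct)
  case const
  show ?case using assms(1)[of 0 0] by simp
next
  case (update f a b)
  have "Poly_Mapping.update a b f = f + Poly_Mapping.single a b"
    using update(1) by (intro poly_mapping_eqI) 
      (auto simp: lookup_update lookup_add lookup_single when_def in_keys_iff)
  then show ?case using update(3) assms by simp
qed

locale unital_algebra = vector_space scale
  for scale :: "'a::field \<Rightarrow> 'b::ring_1 \<Rightarrow> 'b" +
  assumes scale_mult_left: "scale c x * y = scale c (x * y)"
    and scale_mult_right: "x * scale c y = scale c (x * y)"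
begin

lemma scale_power: "scale c x ^ n = scale (c ^ n) (x ^ n)"
  by (induction n) (simp_all add: scale_mult_left scale_mult_right mult.commute)

lemma fa_eval_superset:
  assumes "finite S" "Poly_Mapping.keys f \<subseteq> S"
  shows "fa_eval scale \<phi> f =
    (\<Sum>w\<in>S. scale (Poly_Mapping.lookup f w) (prod_list (map \<phi> (letters w))))"
  unfolding fa_eval_def using assms
  by (intro sum.mono_neutral_left) (auto simp: in_keys_iff)

lemma fa_eval_single [simp]:
  "fa_eval scale \<phi> (Poly_Mapping.single w c) = scale c (prod_list (map \<phi> (letters w)))"
  by (subst fa_eval_superset[of "{w}"]) auto

lemma fa_eval_0 [simp]: "fa_eval scale \<phi> 0 = 0"
  by (simp add: fa_eval_def)

lemma fa_eval_add [simp]: "fa_eval scale \<phi> (f + g) = fa_eval scale \<phi> f + fa_eval scale \<phi> g"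
proof -
  let ?S = "Poly_Mapping.keys f \<union> Poly_Mapping.keys g"
  have "Poly_Mapping.keys (f + g) \<subseteq> ?S" by (rule Poly_Mapping.keys_add)
  then show ?thesis
    by (simp add: fa_eval_superset[of ?S] lookup_add scale_left_distrib sum.distrib)
qed

lemma fa_eval_const [simp]: "fa_eval scale \<phi> (fa_const c) = scale c 1"
  by (simp add: fa_const_def zero_word_def)

lemma fa_eval_1 [simp]: "fa_eval scale \<phi> 1 = 1"
  using fa_eval_const[of \<phi> 1] by (simp add: fa_const_def)

lemma fa_eval_mult [simp]: "fa_eval scale \<phi> (f * g) = fa_eval scale \<phi> f * fa_eval scale \<phi> g"
proof (induction f rule: free_algebra_induct)
  case (single w c)
  show ?case
    by (induction g rule: free_algebra_induct)
      (simp_all add: mult_single plus_word_def scale_mult_left scale_mult_right distrib_left)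
qed (simp add: distrib_right)

text \<open>
  Dependence is stated for lists, so that a repeated vector counts as a dependence.
\<close>

lemma more_vectors_than_generators_dependent:
  assumes "finite B" and "set gs \<subseteq> span B" and "length gs > card B"
  obtains cs where "length cs = length gs" and "(\<Sum>(c, g)\<leftarrow>zip cs gs. scale c g) = 0"
    and "\<exists>c\<in>set cs. c \<noteq> 0"
proof -
  have sum_zip: "(\<Sum>(c, g)\<leftarrow>zip (map u [0..<length gs]) gs. scale c g)
      = (\<Sum>i<length gs. scale (u i) (gs ! i))" for u
    by (auto simp: sum_list_sum_nth atLeast0LessThan intro: sum.cong)
  have "\<exists>u. (\<exists>i<length gs. u i \<noteq> 0) \<and> (\<Sum>i<length gs. scale (u i) (gs ! i)) = 0"
  proof (cases "distinct gs")
    case True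
    have "dependent (set gs)"
      using independent_span_bound[OF assms(1) _ assms(2)] assms(3) distinct_card[OF True] by auto
    then obtain u v where uv: "v \<in> set gs" "u v \<noteq> 0" "(\<Sum>v\<in>set gs. scale (u v) v) = 0"
      using dependent_finite[of "set gs"] by auto
    have "(\<Sum>i<length gs. scale (u (gs ! i)) (gs ! i)) = (\<Sum>v\<in>set gs. scale (u v) v)"
      using bij_betw_nth[OF True refl refl] by (rule sum.reindex_bij_betw)
    with uv show ?thesis by (intro exI[of _ "\<lambda>i. u (gs ! i)"]) (auto simp: in_set_conv_nth)
  next
    case False
    then obtain i j where ij: "i < length gs" "j < length gs" "i \<noteq> j" "gs ! i = gs ! j"
      by (auto simp: distinct_conv_nth)
    let ?u = "\<lambda>k. if k = i then 1 else if k = j then -1 else 0"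
    have "(\<Sum>k<length gs. scale (?u k) (gs ! k))
        = (\<Sum>k<length gs. (if k = i then gs ! i else 0) - (if k = j then gs ! j else 0))"
      using ij by (intro sum.cong) auto
    also have "\<dots> = 0" using ij by (simp add: sum_subtractf)
    finally show ?thesis using ij by (intro exI[of _ ?u]) (auto intro: exI[of _ i])
  qed
  then obtain u where u: "\<exists>i<length gs. u i \<noteq> 0" "(\<Sum>i<length gs. scale (u i) (gs ! i)) = 0"
    by blast
  show thesis
    by (rule that[of "map u [0..<length gs]"]) (use u sum_zip in auto)
qed

text \<open>
  In coordinates with respect to a basis the assumption says that polynomials vanish on the whole
  infinite field.
\<close>

lemma coefficients_zero_if_polynomial_function_zero:
  assumes "infinite (UNIV :: 'a set)" and "finite J" and "\<And>s. (\<Sum>j\<in>J. scale (s ^ k j) (v j)) = 0"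
    and "inj_on k J" and "j \<in> J"
  shows "v j = 0"
proof -
  define B where "B = extend_basis {}"
  have B: "independent B" "span B = UNIV"
    unfolding B_def using independent_extend_basis[of "{}"] span_extend_basis[of "{}"] independent_empty by auto
  have repr0: "representation B (v j) b = 0" for b
  proof -
    define P where "P = (\<Sum>j\<in>J. Polynomial.monom (representation B (v j) b) (k j))"
    have "poly P s = representation B (\<Sum>j\<in>J. scale (s ^ k j) (v j)) b" for s
      using B by (simp add: P_def poly_sum poly_monom representation_sum representation_scale mult.commute)
    then have "poly P s = 0" for s using assms(3) by (simp add: representation_zero)
    then have "P = 0" using assms(1) poly_roots_finite[of P] by auto
    then have "0 = Polynomial.coeff P (k j)" by simp
    also have "\<dots> = (\<Sum>i\<in>J. if i = j then representation B (v i) b else 0)"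
      unfolding P_def coeff_sum using assms(4,5) by (intro sum.cong) (auto dest: inj_onD)
    also have "\<dots> = representation B (v j) b" using assms(2,5) by simp
    finally show ?thesis by simp
  qed
  have "v j = (\<Sum>b | representation B (v j) b \<noteq> 0. scale (representation B (v j) b) b)"
    using sum_nonzero_representation_eq[OF B(1), of "v j"] B(2) by simp
  then show ?thesis by (simp add: repr0)
qed

end


section \<open>Parity in the Grassmann algebra\<close>

text \<open>
  The binomial formula for commuting elements in a ring that need not be commutative; all terms
  with \<open>u\<^sup>2\<close> drop out.
\<close>

lemma power_add_square_zero:
  fixes x u :: "'b::ring_1"
  assumes "x * u = u * x" and "u * u = 0"
  shows "(x + u) ^ Suc n = x ^ Suc n + of_nat (Suc n) * x ^ n * u"
proof (induction n)
  case (Suc n)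
  have comm: "u * x ^ k = x ^ k * u" for k
    using power_commuting_commutes[OF assms(1), of k] by simp
  have "(x + u) ^ Suc (Suc n) = (x + u) ^ Suc n * (x + u)"
    by (rule power_Suc2)
  also have "\<dots> = x ^ Suc n * x + of_nat (Suc n) * x ^ n * (u * x)
      + (x ^ Suc n * u + of_nat (Suc n) * x ^ n * (u * u))"
    unfolding Suc.IH by (simp only: distrib_left distrib_right mult.assoc add_ac)
  also have "x ^ Suc n * x = x ^ Suc (Suc n)"
    by (rule power_Suc2[symmetric])
  also have "of_nat (Suc n) * x ^ n * (u * x) = of_nat (Suc n) * x ^ Suc n * u"
    unfolding assms(1)[symmetric] by (simp only: mult.assoc power_Suc2)
  also have "x ^ Suc (Suc n) + of_nat (Suc n) * x ^ Suc n * u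
      + (x ^ Suc n * u + of_nat (Suc n) * x ^ n * (u * u))
      = x ^ Suc (Suc n) + of_nat (Suc (Suc n)) * x ^ Suc n * u"
    by (simp add: assms(2) algebra_simps)
  finally show ?case .
qed simp

text \<open>
  The multinomial formula: only the products of distinct summands survive, and there are
  \<open>n!\<close> orders of all \<open>n\<close> of them. In characteristic 0 the
  \<open>n\<close>-th power is therefore nonzero as soon as the product of the summands is.
\<close>

lemma power_sum_list_square_zero:
  fixes qs :: "'b::ring_1 list"
  assumes "\<And>x y. x \<in> set qs \<Longrightarrow> y \<in> set qs \<Longrightarrow> x * y = y * x" and "\<And>x. x \<in> set qs \<Longrightarrow> x * x = 0"
  shows "sum_list qs ^ length qs = of_nat (fact (length qs)) * prod_list qs"
proof -
  \<comment> \<open>The vanishing of the next power is what makes the induction go through.\<close>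
  have "sum_list qs ^ length qs = of_nat (fact (length qs)) * prod_list qs \<and>
      sum_list qs ^ Suc (length qs) = 0"
    using assms
  proof (induction qs)
    case (Cons q qs)
    let ?s = "sum_list qs" and ?n = "length qs"
    have IH: "?s ^ ?n = of_nat (fact ?n) * prod_list qs" "?s ^ Suc ?n = 0"
      using Cons.IH Cons.prems by (auto simp del: power_Suc)
    have comm: "?s * q = q * ?s" 
    proof -
      have "\<forall>x\<in>set qs. x * q = q * x" using Cons.prems(1) by simp
      then show ?thesis by (induction qs) (simp_all add: algebra_simps)
    qed
    have commp: "q * prod_list qs = prod_list qs * q" 
    proof -
      have "\<forall>x\<in>set qs. x * q = q * x" using Cons.prems(1) by simp
      then show ?thesis by (induction qs) (simp_all, metis mult.assoc)
    qed
    have sq: "q * q = 0" using Cons.prems(2) by simp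
    have "(?s + q) ^ Suc ?n = of_nat (Suc ?n) * ?s ^ ?n * q"
      using power_add_square_zero[OF comm sq, of ?n] IH(2) by simp
    also have "\<dots> = of_nat (fact (Suc ?n)) * (q * prod_list qs)"
      by (simp only: IH(1) fact_Suc of_nat_mult commp mult.assoc of_nat_id)
    finally have 1: "(q + ?s) ^ Suc ?n = of_nat (fact (Suc ?n)) * (q * prod_list qs)"
      by (simp add: add.commute)
    have "(?s + q) ^ Suc (Suc ?n) = 0"
      using power_add_square_zero[OF comm sq, of "Suc ?n"] IH(2) by simp
    then show ?case using 1 by (simp add: add.commute)
  qed simp
  then show ?thesis by blast
qed

interpretation grassmann_algebra: unital_algebra "grassmann_scale :: 'a::field \<Rightarrow> _"
proof
  fix c :: 'a and x y :: "'a grassmann"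
  show "grassmann_scale c x * y = grassmann_scale c (x * y)"
    by transfer (simp add: mult.assoc grassmann_rel_def grassmann_ideal_0)
  have "f * fa_const c = fa_const c * f" for f :: "(nat, 'a) free_algebra"
    by (induction f rule: free_algebra_induct)
      (simp_all add: fa_const_def mult_single algebra_simps)
  then have "f * (fa_const c * g) = fa_const c * (f * g)" for f g :: "(nat, 'a) free_algebra"
    by (metis mult.assoc)
  then show "x * grassmann_scale c y = grassmann_scale c (x * y)"
    by transfer (simp add: grassmann_rel_def grassmann_ideal_0)
qed

lemma grassmann_monomial_0: "grassmann_monomial 0 = 1"
  by transfer (simp add: grassmann_rel_def grassmann_ideal_0)

lemma grassmann_monomial_mult:
  "grassmann_monomial u * grassmann_monomial v = grassmann_monomial (u + v)"
  by transfer (simp add: grassmann_rel_def grassmann_ideal_0 mult_single)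

abbreviation gen :: "nat \<Rightarrow> 'a::field grassmann" where "gen i \<equiv> grassmann_monomial (Word [i])"

lemma grassmann_monomial_Cons: "grassmann_monomial (Word (i # w)) = gen i * grassmann_monomial (Word w)"
  by (simp add: grassmann_monomial_mult plus_word_def)

lemma generators_anticommute: "gen i * gen j = - (gen j * gen i :: 'a::field grassmann)"
proof -
  have "(fa_var i * fa_var j + fa_var j * fa_var i :: (nat, 'a) free_algebra) \<in> grassmann_ideal"
    unfolding grassmann_ideal_def
    by (rule set_mp[OF ring.genideal_self[OF ring_of_type_algebra_ring]])
      (auto simp: grassmann_relators_def ring_of_type_algebra_def)
  then have "gen i * gen j + gen j * gen i = (0 :: 'a grassmann)"
    by transfer (simp add: grassmann_rel_def fa_var_def)
  then show ?thesis by (simp add: eq_neg_iff_add_eq_0)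
qed

text \<open>
  Passing each of the \<open>k\<close> letters of \<open>u\<close> over each of the
  \<open>l\<close> letters of \<open>v\<close> gives the sign \<open>(-
  1)\<^bsup>kl\<^esup>\<close>.
\<close>

lemma grassmann_monomial_commute:
  "grassmann_monomial u * grassmann_monomial v =
    (if odd (length (letters u)) \<and> odd (length (letters v))
     then - (grassmann_monomial v * grassmann_monomial u)
     else grassmann_monomial v * grassmann_monomial u :: 'a::field grassmann)"
proof -
  have nil: "grassmann_monomial (Word []) = (1 :: 'a grassmann)"
    using grassmann_monomial_0 by (simp add: zero_word_def)
  have 1: "gen i * grassmann_monomial (Word v) =
    (if odd (length v) then - (grassmann_monomial (Word v) * gen i)
     else grassmann_monomial (Word v) * gen i :: 'a grassmann)" for i v
  proof (induction v)
    case (Cons j v)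
    have "gen i * grassmann_monomial (Word (j # v))
        = - (gen j * (gen i * grassmann_monomial (Word v)) :: 'a grassmann)"
      unfolding grassmann_monomial_Cons[of j v] mult.assoc[symmetric]
      by (simp add: generators_anticommute[of i j])
    also have "\<dots> = - (gen j * (if odd (length v) then - (grassmann_monomial (Word v) * gen i)
        else grassmann_monomial (Word v) * gen i))"
      by (simp only: Cons.IH)
    finally show ?case
      by (cases "odd (length v)") (simp_all add: grassmann_monomial_Cons[of j v] mult.assoc)
  qed (simp add: nil)
  have "grassmann_monomial (Word u) * grassmann_monomial (Word v) =
    (if odd (length u) \<and> odd (length v)
     then - (grassmann_monomial (Word v) * grassmann_monomial (Word u))
     else grassmann_monomial (Word v) * grassmann_monomial (Word u) :: 'a grassmann)" for u v
  proof (induction u)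
    case (Cons i u)
    have "grassmann_monomial (Word (i # u)) * grassmann_monomial (Word v)
        = gen i * (grassmann_monomial (Word u) * grassmann_monomial (Word v) :: 'a grassmann)"
      by (simp add: grassmann_monomial_Cons[of i u] mult.assoc)
    also have "\<dots> = (if odd (length u) \<and> odd (length v)
        then - (gen i * grassmann_monomial (Word v) * grassmann_monomial (Word u))
        else gen i * grassmann_monomial (Word v) * grassmann_monomial (Word u))"
      by (simp add: Cons mult.assoc)
    finally show ?case by (simp add: 1[of i v] grassmann_monomial_Cons[of i u] mult.assoc)
  qed (simp add: nil)
  from this[of "letters u" "letters v"] show ?thesis by simp
qed

text \<open>
  Even and odd refer to the length of the monomials, not to the grading \<open>d\<close>: it is
  the length that decides whether elements of \<open>E\<close> commute or anticommute.
\<close>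

definition even_part :: "bit \<Rightarrow> 'a::field grassmann set" where
  "even_part d = grassmann.span {grassmann_monomial w | w. even (length (letters w)) \<and> E_inf_degree w = d}"

definition odd_part :: "bit \<Rightarrow> 'a::field grassmann set" where
  "odd_part d = grassmann.span {grassmann_monomial w | w. odd (length (letters w)) \<and> E_inf_degree w = d}"

lemma E_inf_component_parity:
  fixes x :: "'a::field grassmann"
  assumes "x \<in> E_inf_component d"
  obtains a b where "x = a + b" and "a \<in> even_part d" and "b \<in> odd_part d"
proof -
  let ?A = "{grassmann_monomial w | w. even (length (letters w)) \<and> E_inf_degree w = d} :: 'a grassmann set"
    and ?B = "{grassmann_monomial w | w. odd (length (letters w)) \<and> E_inf_degree w = d} :: 'a grassmann set"
  have "{grassmann_monomial w | w. E_inf_degree w = d} = ?A \<union> ?B" by auto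
  then have "x \<in> grassmann.span (?A \<union> ?B)"
    using assms unfolding E_inf_component_def by (simp only:)
  then show thesis
    using that unfolding grassmann.span_Un even_part_def odd_part_def by auto
qed

lemma span_bilinear:
  assumes "x \<in> grassmann.span S" and "y \<in> grassmann.span T"
    and "\<And>u v. u \<in> S \<Longrightarrow> v \<in> T \<Longrightarrow> u * v = grassmann_scale c (v * u)"
  shows "x * y = grassmann_scale c (y * x)"
  using assms(1)
proof (induction rule: grassmann.span_induct_alt)
  case (step a u x)
  have "u * y = grassmann_scale c (y * u)"
    using assms(2)
  proof (induction rule: grassmann.span_induct_alt)
    case (step b v z)
    then show ?case using assms(3)[of u v] \<open>u \<in> S\<close>
      by (simp add: algebra_simps grassmann_algebra.scale_mult_left
        grassmann_algebra.scale_mult_right grassmann.scale_right_distrib)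
  qed simp
  with step show ?case
    by (simp add: algebra_simps grassmann_algebra.scale_mult_left
        grassmann_algebra.scale_mult_right grassmann.scale_right_distrib)
qed simp

lemma even_part_commute:
  assumes "a \<in> even_part d"
  shows "x \<in> even_part d' \<Longrightarrow> a * x = x * a" and "x \<in> odd_part d' \<Longrightarrow> a * x = x * a"
proof -
  have *: "grassmann_monomial u * grassmann_monomial v =
      (grassmann_monomial v * grassmann_monomial u :: 'a grassmann)" if "even (length (letters u))" for u v
    using grassmann_monomial_commute[of u v, where 'a='a] that by simp
  show "a * x = x * a" if "x \<in> even_part d'"
  proof -
    have "a * x = grassmann_scale 1 (x * a)"
      using assms that unfolding even_part_def odd_part_def
      by (rule span_bilinear) (clarsimp, rule *, assumption)
    then show ?thesis by simp
  qed
  show "a * x = x * a" if "x \<in> odd_part d'"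
  proof -
    have "a * x = grassmann_scale 1 (x * a)"
      using assms that unfolding even_part_def odd_part_def
      by (rule span_bilinear) (clarsimp, rule *, assumption)
    then show ?thesis by simp
  qed
qed

lemma odd_part_anticommute:
  fixes a :: "'a::field grassmann"
  assumes "a \<in> odd_part d" and "b \<in> odd_part d'" shows "a * b = - (b * a)"
proof -
  have *: "grassmann_monomial u * grassmann_monomial v =
      (- (grassmann_monomial v * grassmann_monomial u) :: 'a grassmann)"
    if "odd (length (letters u))" "odd (length (letters v))" for u v
    using grassmann_monomial_commute[of u v, where 'a='a] that by simp
  have "a * b = grassmann_scale (- 1) (b * a)"
    using assms unfolding odd_part_def by (rule span_bilinear) (clarsimp, rule *, assumption+)
  then show ?thesis by simp
qed

lemma eq_uminus_imp_0:
  fixes x :: "'a::field grassmann"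
  assumes "(2 :: 'a) \<noteq> 0" and "x = - x"
  shows "x = 0"
proof -
  have "grassmann_scale 2 x = x + x"
    using grassmann.scale_left_distrib[of 1 1 x] by simp
  also have "\<dots> = 0" using assms(2) by (metis add.right_inverse)
  finally show ?thesis using assms(1) by simp
qed

lemma odd_part_square:
  fixes b :: "'a::field grassmann"
  assumes "(2 :: 'a) \<noteq> 0" and "b \<in> odd_part d" shows "b * b = 0"
  using odd_part_anticommute[OF assms(2,2)] by (rule eq_uminus_imp_0[OF assms(1)])

lemma grassmann_monomial_square:
  assumes "(2 :: 'a::field) \<noteq> 0" and "letters w \<noteq> []"
  shows "grassmann_monomial w * grassmann_monomial w = (0 :: 'a grassmann)"
proof -
  obtain i v where w: "w = Word (i # v)" using assms(2) by (cases w; cases "letters w") auto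
  have ee: "gen i * gen i = (0 :: 'a grassmann)"
    by (rule eq_uminus_imp_0[OF assms(1) generators_anticommute])
  let ?v = "grassmann_monomial (Word v) :: 'a grassmann"
  have eex: "gen i * (gen i * x) = 0" for x :: "'a grassmann"
    by (simp add: mult.assoc[symmetric] ee)
  have "?v * gen i = gen i * ?v \<or> ?v * gen i = - (gen i * ?v)"
    using grassmann_monomial_commute[of "Word v" "Word [i]", where 'a='a] by auto
  then have "gen i * (?v * gen i) = 0"
    using eex by auto
  moreover have "gen i * ?v * (gen i * ?v) = gen i * (?v * gen i) * ?v"
    by (simp only: mult.assoc)
  ultimately have "gen i * ?v * (gen i * ?v) = 0" by simp
  then show ?thesis by (simp add: w grassmann_monomial_Cons[of i v])
qed

lemma of_nat_grassmann: "(of_nat n :: 'a::field grassmann) = grassmann_scale (of_nat n) 1"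
  by (induction n) (simp_all add: grassmann.scale_left_distrib)

text \<open>
  Adding a term \<open>u\<close> with \<open>u\<^sup>2 = 0\<close> that commutes with
  \<open>x\<close> changes \<open>x\<^sup>p\<close> by \<open>p x\<^bsup>p - 1\<^esup> u =
  0\<close>. Degree 1 rules out the constant monomial 1, the only even monomial whose square is
  not 0.
\<close>

lemma even_part_nilpotent:
  fixes a :: "'a::field grassmann"
  assumes "CHAR('a) = p" and "p > 2" and "a \<in> even_part 1"
  shows "a ^ p = 0"
proof -
  obtain n where n: "p = Suc n" using assms(2) by (cases p) auto
  have two: "(2 :: 'a) \<noteq> 0"
  proof
    assume "(2 :: 'a) = 0"
    then have "of_nat 2 = (0 :: 'a)" by simp
    then have "p dvd 2" using assms(1) by (simp only: of_nat_eq_0_iff_char_dvd)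
    then show False using assms(2) by (auto dest: dvd_imp_le)
  qed
  have p0: "of_nat p = (0 :: 'a grassmann)"
    using assms(1) by (simp add: of_nat_grassmann of_nat_eq_0_iff_char_dvd)
  have "a \<in> even_part 1 \<and> a ^ p = 0"
    using assms(3)[unfolded even_part_def]
  proof (induction rule: grassmann.span_induct_alt)
    case base
    show ?case by (simp add: n even_part_def grassmann.span_zero)
  next
    case (step c u x)
    then obtain w where w: "u = grassmann_monomial w" "even (length (letters w))" "E_inf_degree w = 1"
      by auto
    have "letters w \<noteq> []" using w(3) by (auto simp: E_inf_degree_def)
    then have sq: "u * u = 0" using grassmann_monomial_square[OF two] w by simp
    have u: "u \<in> even_part 1" using step(1) unfolding even_part_def by (rule grassmann.span_base)
    then have "x * u = u * x" using even_part_commute(1) step(2) by blast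
    then have "(x + grassmann_scale c u) ^ Suc n = x ^ Suc n + of_nat (Suc n) * x ^ n * grassmann_scale c u"
      using sq by (intro power_add_square_zero)
        (simp_all add: grassmann_algebra.scale_mult_left grassmann_algebra.scale_mult_right)
    then have "(grassmann_scale c u + x) ^ p = 0"
      using step(2) p0 unfolding n by (simp only: add.commute) simp
    moreover have "grassmann_scale c u + x \<in> even_part 1"
      using u step(2) unfolding even_part_def
      by (blast intro: grassmann.span_add grassmann.span_scale)
    ultimately show ?case by blast
  qed
  then show ?thesis by blast
qed



section \<open>Monomials without repeated generators\<close>

text \<open>
  The sign of the permutation that sorts the list, and 0 for a list with a repeated entry.
  Extended linearly to the free algebra, it vanishes on the Grassmann relations but on no monomial
  with distinct letters.
\<close>

fun sorting_sign :: "nat list \<Rightarrow> 'a::field" where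
  "sorting_sign [] = 1"
| "sorting_sign (x # xs) =
    (\<Prod>y\<leftarrow>xs. if x < y then 1 else if y < x then - 1 else 0) * sorting_sign xs"

lemma sorting_sign_swap:
  "sorting_sign (u @ i # j # v) = - (sorting_sign (u @ j # i # v) :: 'a::field)"
  by (induction u) auto

lemma sorting_sign_distinct: "distinct w \<Longrightarrow> sorting_sign w \<noteq> (0 :: 'a::field)"
  by (induction w) (auto simp: prod_list_zero_iff)

definition sign_functional :: "(nat, 'a::field) free_algebra \<Rightarrow> 'a" where
  "sign_functional f =
    (\<Sum>w\<in>Poly_Mapping.keys f. Poly_Mapping.lookup f w * sorting_sign (letters w))"

lemma sign_functional_superset:
  assumes "finite S" "Poly_Mapping.keys f \<subseteq> S"
  shows "sign_functional f = (\<Sum>w\<in>S. Poly_Mapping.lookup f w * sorting_sign (letters w))"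
  unfolding sign_functional_def using assms
  by (intro sum.mono_neutral_left) (auto simp: in_keys_iff)

lemma sign_functional_single: "sign_functional (Poly_Mapping.single w c) = c * sorting_sign (letters w)"
  by (subst sign_functional_superset[of "{w}"]) auto

lemma sign_functional_add: "sign_functional (f + g) = sign_functional f + sign_functional g"
proof -
  let ?S = "Poly_Mapping.keys f \<union> Poly_Mapping.keys g"
  have "Poly_Mapping.keys (f + g) \<subseteq> ?S" by (rule Poly_Mapping.keys_add)
  then show ?thesis
    by (simp add: sign_functional_superset[of ?S] lookup_add distrib_right sum.distrib)
qed

lemma sign_functional_uminus: "sign_functional (- f) = - sign_functional f"
  using sign_functional_add[of f "- f"] 
  by (simp add: eq_neg_iff_add_eq_0 add.commute sign_functional_def[of 0])

text \<open>
  The largest two-sided ideal on which the functional vanishes contains the relators, because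
  exchanging two adjacent letters changes the sign.
\<close>

lemma sign_functional_grassmann_ideal:
  assumes "f \<in> grassmann_ideal"
  shows "sign_functional f = 0"
proof -
  let ?I = "{f :: (nat, 'a) free_algebra. \<forall>g h. sign_functional (g * f * h) = 0}"
  have "ideal ?I ring_of_type_algebra"
  proof (rule idealI[OF ring_of_type_algebra_ring])
    show "subgroup ?I (add_monoid ring_of_type_algebra)"
    proof (rule group.subgroupI)
      show "group (add_monoid (ring_of_type_algebra :: (nat, 'a) free_algebra ring))"
        using ring_of_type_algebra_ring by (rule abelian_group.a_group[OF ring.is_abelian_group])
      fix a :: "(nat, 'a) free_algebra" assume a: "a \<in> ?I"
      have "inv\<^bsub>add_monoid ring_of_type_algebra\<^esub> a = - a"
        by (rule group.inv_equality[OF \<open>group _\<close>]) (simp_all add: ring_of_type_algebra_def)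
      with a show "inv\<^bsub>add_monoid ring_of_type_algebra\<^esub> a \<in> ?I"
        by (simp add: sign_functional_uminus)
    qed (auto simp: ring_of_type_algebra_def distrib_left distrib_right sign_functional_add
        sign_functional_def[of 0] intro: exI[of _ 0])
    fix a x :: "(nat, 'a) free_algebra" assume "a \<in> ?I"
    then show "x \<otimes>\<^bsub>ring_of_type_algebra\<^esub> a \<in> ?I" and "a \<otimes>\<^bsub>ring_of_type_algebra\<^esub> x \<in> ?I"
      by (simp_all add: ring_of_type_algebra_def, metis mult.assoc, metis mult.assoc)
  qed
  moreover have "grassmann_relators \<subseteq> ?I"
  proof
    fix r :: "(nat, 'a) free_algebra" assume "r \<in> grassmann_relators"
    then obtain i j where r: "r = fa_var i * fa_var j + fa_var j * fa_var i"
      by (auto simp: grassmann_relators_def)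
    have "sign_functional (g * r * h) = 0" for g h
    proof (induction g rule: free_algebra_induct)
      case (single u a)
      show ?case
      proof (induction h rule: free_algebra_induct)
        case (single v b)
        show ?case
          using sorting_sign_swap[of "letters u" i j "letters v", where 'a='a]
          by (simp add: r fa_var_def distrib_left distrib_right mult_single sign_functional_add
              sign_functional_single plus_word_def)
      qed (simp add: distrib_left sign_functional_add)
    qed (simp add: distrib_right sign_functional_add)
    then show "r \<in> ?I" by blast
  qed
  ultimately have "grassmann_ideal \<subseteq> ?I"
    unfolding grassmann_ideal_def by (rule ring.genideal_minimal[OF ring_of_type_algebra_ring])
  then have "sign_functional (1 * f * 1) = 0" using assms by blast
  then show ?thesis by simp
qed

text \<open>
  The sign functional is well defined on \<open>E\<close> and takes the value \<open>1\<close> or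
  \<open>- 1\<close> at the monomial.
\<close>

lemma grassmann_monomial_distinct:
  assumes "distinct (letters w)"
  shows "grassmann_monomial w \<noteq> (0 :: 'a::field grassmann)"
proof
  assume "grassmann_monomial w = (0 :: 'a grassmann)"
  then have "Poly_Mapping.single w (1 :: 'a) \<in> grassmann_ideal"
    by transfer (simp add: grassmann_rel_def)
  then show False
    using sign_functional_grassmann_ideal sorting_sign_distinct[OF assms, where 'a='a]
    by (fastforce simp: sign_functional_single)
qed


section \<open>Words in sums of central and anticommuting elements\<close>

context unital_algebra
begin

text \<open>
  Multiplying a product of powers of the \<open>a\<close>'s and of distinct \<open>b\<close>'s by
  some \<open>a w + b w\<close> gives a sum of two such products, or 0 where \<open>b w\<close>
  occurs already or \<open>a w\<close> reaches the exponent \<open>q\<close>. Only the variables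
  in \<open>S\<close> have unbounded exponents, and \<open>card S\<close> is the degree of growth.
  The set \<open>S\<close> is everything in characteristic 0 and the variables of degree 0 in
  characteristic \<open>p\<close>.
\<close>

lemma span_words_supercommuting:
  fixes x a b :: "'v \<Rightarrow> 'b"
  assumes "finite V" and "S \<subseteq> V" and "q > 0"
    and x: "\<And>v. v \<in> V \<Longrightarrow> x v = a v + b v"
    and aa: "\<And>u v. u \<in> V \<Longrightarrow> v \<in> V \<Longrightarrow> a u * a v = a v * a u"
    and ab: "\<And>u v. u \<in> V \<Longrightarrow> v \<in> V \<Longrightarrow> a u * b v = b v * a u"
    and bb: "\<And>u v. u \<in> V \<Longrightarrow> v \<in> V \<Longrightarrow> b u * b v = - (b v * b u)"
    and b2: "\<And>v. v \<in> V \<Longrightarrow> b v * b v = 0"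
    and aq: "\<And>v. v \<in> V - S \<Longrightarrow> a v ^ q = 0"
  obtains C where "C > 0"
    and "\<And>n. \<exists>B. finite B \<and> card B \<le> C * (n + 1) ^ card S \<and>
      (\<forall>ws. set ws \<subseteq> V \<and> length ws \<le> n \<longrightarrow> prod_list (map x ws) \<in> span B)"
proof -
  obtain xs where xs: "set xs = V" "distinct xs"
    using finite_distinct_list[OF \<open>finite V\<close>] by blast
  define D where "D = {bs. distinct bs \<and> set bs \<subseteq> V}"
  \<comment> \<open>Outside \<open>S\<close> the \<open>q\<close>-th power vanishes, so exponents stop at \<open>q - 1\<close> there.\<close>
  define cap where "cap n v = (if v \<in> S then n else q - 1)" for n v
  define \<Gamma> where "\<Gamma> n = PiE V (\<lambda>v. {..cap n v})" for n
  define mon where "mon \<gamma> bs = prod_list (map (\<lambda>v. a v ^ \<gamma> v) xs) * prod_list (map b bs)" for \<gamma> bs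
  define G where "G n = (\<lambda>(\<gamma>, bs). mon \<gamma> bs) ` (\<Gamma> n \<times> D)" for n
  have "finite D"
    unfolding D_def using finite_subset_distinct[OF \<open>finite V\<close>] by (simp add: conj_commute)
  have fin\<Gamma>: "finite (\<Gamma> n)" for n
    unfolding \<Gamma>_def using \<open>finite V\<close> by (intro finite_PiE) auto
  have "[] \<in> D" by (simp add: D_def)
  have card\<Gamma>: "card (\<Gamma> n) = (n + 1) ^ card S * q ^ card (V - S)" for n
  proof -
    have "card (\<Gamma> n) = (\<Prod>v\<in>V. cap n v + 1)"
      unfolding \<Gamma>_def using \<open>finite V\<close> by (simp add: card_PiE)
    also have "\<dots> = (\<Prod>v\<in>S. cap n v + 1) * (\<Prod>v\<in>V - S. cap n v + 1)"
      using prod.subset_diff[OF \<open>S \<subseteq> V\<close> \<open>finite V\<close>] by (simp add: mult.commute)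
    finally show ?thesis using \<open>q > 0\<close> by (simp add: cap_def)
  qed
  have cardG: "card (G n) \<le> q ^ card (V - S) * card D * (n + 1) ^ card S" for n
    using card_image_le[of "\<Gamma> n \<times> D" "\<lambda>(\<gamma>, bs). mon \<gamma> bs"] fin\<Gamma>[of n] \<open>finite D\<close>
    by (simp add: G_def card\<Gamma> algebra_simps card_cartesian_product)
  have amon: "a w * mon \<gamma> bs = mon (\<gamma>(w := Suc (\<gamma> w))) bs" if "w \<in> V" for w \<gamma> bs
  proof -
    have apow: "a w * a v ^ k = a v ^ k * a w" if "v \<in> V" for v k
      using power_commuting_commutes[OF aa[OF \<open>v \<in> V\<close> \<open>w \<in> V\<close>]] by simp
    have "a w * prod_list (map (\<lambda>v. a v ^ \<gamma> v) ys)
        = prod_list (map (\<lambda>v. a v ^ (\<gamma>(w := Suc (\<gamma> w))) v) ys)"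
      if "w \<in> set ys" "distinct ys" "set ys \<subseteq> V" for ys
      using that
    proof (induction ys)
      case (Cons y ys)
      show ?case
      proof (cases "y = w")
        case True
        with Cons.prems have "map (\<lambda>v. a v ^ (\<gamma>(w := Suc (\<gamma> w))) v) ys = map (\<lambda>v. a v ^ \<gamma> v) ys"
          by auto
        then show ?thesis by (simp only: True list.map prod_list.Cons fun_upd_same power_Suc mult.assoc)
      next
        case False
        with Cons.prems have "w \<in> set ys" by auto
        have "a w * (a y ^ \<gamma> y * prod_list (map (\<lambda>v. a v ^ \<gamma> v) ys))
            = a y ^ \<gamma> y * (a w * prod_list (map (\<lambda>v. a v ^ \<gamma> v) ys))"
          using apow[of y "\<gamma> y"] Cons.prems by (simp add: mult.assoc[symmetric])
        then show ?thesis using Cons False \<open>w \<in> set ys\<close> by simp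
      qed
    qed simp
    from this[of xs] show ?thesis
      using xs \<open>w \<in> V\<close> by (simp add: mon_def mult.assoc[symmetric])
  qed
  have bmon: "b w * mon \<gamma> bs = mon \<gamma> (w # bs)" if "w \<in> V" for w \<gamma> bs
  proof -
    have bpow: "b w * a v ^ k = a v ^ k * b w" if "v \<in> V" for v k
      using power_commuting_commutes[OF ab[OF \<open>v \<in> V\<close> \<open>w \<in> V\<close>]] by simp
    have "b w * prod_list (map (\<lambda>v. a v ^ \<gamma> v) ys) = prod_list (map (\<lambda>v. a v ^ \<gamma> v) ys) * b w"
      if "set ys \<subseteq> V" for ys
      using that
    proof (induction ys)
      case (Cons y ys)
      then show ?case using bpow[of y "\<gamma> y"] by (simp, metis mult.assoc)
    qed simp
    from this[of xs] show ?thesis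
      using xs by (simp add: mon_def mult.assoc[symmetric])
  qed
  have brep: "b w * prod_list (map b bs) = 0" if "w \<in> set bs" "set bs \<subseteq> V" for w bs
    using that
  proof (induction bs)
    case (Cons c bs)
    show ?case
    proof (cases "w = c")
      case True
      then show ?thesis using b2[of c] Cons.prems by (simp add: mult.assoc[symmetric])
    next
      case False
      have "b w * (b c * prod_list (map b bs)) = - (b c * (b w * prod_list (map b bs)))"
        using bb[of w c] Cons.prems False by (auto simp add: mult.assoc[symmetric])
      then show ?thesis using Cons False by simp
    qed
  qed simp
  have step: "x w * g \<in> span (G (Suc n))" if "w \<in> V" and "g \<in> G n" for w g n
  proof -
    from \<open>g \<in> G n\<close> obtain \<gamma> bs where g: "g = mon \<gamma> bs" "\<gamma> \<in> \<Gamma> n" "bs \<in> D"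
      by (auto simp: G_def)
    have "\<Gamma> n \<subseteq> \<Gamma> (Suc n)" unfolding \<Gamma>_def by (intro PiE_mono) (auto simp: cap_def)
    have "a w * g \<in> span (G (Suc n))"
    proof (cases "\<gamma>(w := Suc (\<gamma> w)) \<in> \<Gamma> (Suc n)")
      case True
      then have "a w * g \<in> G (Suc n)"
        using g amon[OF \<open>w \<in> V\<close>] by (auto simp: G_def)
      then show ?thesis by (rule span_base)
    next
      case False
      have "\<gamma>(w := Suc (\<gamma> w)) \<in> \<Gamma> (Suc n)" if le: "Suc (\<gamma> w) \<le> cap (Suc n) w"
      proof -
        have "\<gamma>(w := Suc (\<gamma> w)) \<in> Pi V (\<lambda>v. {..cap (Suc n) v})"
        proof (rule Pi_I)
          fix v assume "v \<in> V"
          then have "\<gamma> v \<in> {..cap n v}" using g(2) unfolding \<Gamma>_def by (rule PiE_mem[rotated])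
          then show "(\<gamma>(w := Suc (\<gamma> w))) v \<in> {..cap (Suc n) v}"
            using le by (auto simp: cap_def split: if_splits)
        qed
        moreover have "\<gamma>(w := Suc (\<gamma> w)) \<in> extensional V"
          using g(2) \<open>w \<in> V\<close> by (auto simp: \<Gamma>_def PiE_def extensional_def)
        ultimately show ?thesis unfolding \<Gamma>_def PiE_def by blast
      qed
      then have "\<not> Suc (\<gamma> w) \<le> cap (Suc n) w" using False by blast
      moreover have "\<gamma> w \<le> cap n w" using g(2) \<open>w \<in> V\<close> by (auto simp: \<Gamma>_def)
      ultimately have "w \<in> V - S" "Suc (\<gamma> w) = q"
        using \<open>w \<in> V\<close> \<open>q > 0\<close> by (auto simp: cap_def split: if_splits)
      then have "0 \<in> set (map (\<lambda>v. a v ^ (\<gamma>(w := Suc (\<gamma> w))) v) xs)"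
        using aq[of w] xs by (auto simp: image_iff intro!: bexI[of _ w])
      then have "prod_list (map (\<lambda>v. a v ^ (\<gamma>(w := Suc (\<gamma> w))) v) xs) = 0"
      proof -
        have "0 \<in> set zs \<Longrightarrow> prod_list zs = 0" for zs :: "'b list"
          by (induction zs) auto
        then show ?thesis using \<open>0 \<in> set _\<close> by blast
      qed
      then have "a w * g = 0" using g amon[OF \<open>w \<in> V\<close>] by (simp add: mon_def)
      then show ?thesis by (simp add: span_zero)
    qed
    moreover have "b w * g \<in> span (G (Suc n))"
    proof (cases "w \<in> set bs")
      case True
      then have "prod_list (map b (w # bs)) = 0" using g(3) brep by (auto simp: D_def)
      then have "b w * g = 0" using g bmon[OF \<open>w \<in> V\<close>] by (simp add: mon_def)
      then show ?thesis by (simp add: span_zero)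
    next
      case False
      then have "w # bs \<in> D" using g(3) \<open>w \<in> V\<close> by (simp add: D_def)
      then have "b w * g \<in> G (Suc n)"
        using g bmon[OF \<open>w \<in> V\<close>] \<open>\<Gamma> n \<subseteq> _\<close> by (auto simp: G_def)
      then show ?thesis by (rule span_base)
    qed
    ultimately show ?thesis using x[OF \<open>w \<in> V\<close>] by (simp add: distrib_right span_add)
  qed
  have words: "prod_list (map x ws) \<in> span (G (length ws))" if "set ws \<subseteq> V" for ws
    using that
  proof (induction ws)
    case Nil
    let ?\<gamma> = "\<lambda>v\<in>V. 0 :: nat"
    have "map (\<lambda>v. a v ^ ?\<gamma> v) xs = map (\<lambda>v. 1) xs" using xs by auto
    then have "mon ?\<gamma> [] = 1" by (simp add: mon_def map_replicate_const del: map_eq_conv)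
    moreover have "?\<gamma> \<in> \<Gamma> 0" by (auto simp: \<Gamma>_def)
    ultimately have "1 \<in> G 0" using \<open>[] \<in> D\<close> by (force simp: G_def)
    then show ?case by (simp add: span_base)
  next
    case (Cons w ws)
    have "x w * y \<in> span (G (Suc (length ws)))" if "y \<in> span (G (length ws))" for y
      using that
    proof (induction rule: span_induct_alt)
      case base
      show ?case by (simp add: span_zero)
    next
      case (step c g y)
      then show ?case
        using \<open>\<And>w g n. w \<in> V \<Longrightarrow> g \<in> G n \<Longrightarrow> _\<close> Cons.prems
        by (simp add: distrib_left scale_mult_right span_add span_scale)
    qed
    then show ?case using Cons by simp
  qed
  have mono: "G k \<subseteq> G n" if "k \<le> n" for k n
  proof -
    have "\<Gamma> k \<subseteq> \<Gamma> n" unfolding \<Gamma>_def using that by (intro PiE_mono) (auto simp: cap_def)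
    then show ?thesis by (auto simp: G_def)
  qed
  show thesis
  proof (rule that)
    show "q ^ card (V - S) * card D > 0"
      using \<open>q > 0\<close> \<open>finite D\<close> \<open>[] \<in> D\<close> by (auto simp: card_gt_0_iff)
    show "\<exists>B. finite B \<and> card B \<le> q ^ card (V - S) * card D * (n + 1) ^ card S \<and>
      (\<forall>ws. set ws \<subseteq> V \<and> length ws \<le> n \<longrightarrow> prod_list (map x ws) \<in> span B)" for n
    proof (intro exI conjI allI impI)
      show "finite (G n)" using fin\<Gamma> \<open>finite D\<close> by (simp add: G_def)
      show "card (G n) \<le> q ^ card (V - S) * card D * (n + 1) ^ card S" by (rule cardG)
      show "prod_list (map x ws) \<in> span (G n)" if "set ws \<subseteq> V \<and> length ws \<le> n" for ws
        using that words[of ws] span_mono[OF mono[of "length ws" n]] by blast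
    qed
  qed
qed

end


section \<open>Growth of filtered algebras\<close>

text \<open>
  An exhaustive filtration by subspaces of dimension at most \<open>D n\<close>. The bound is on
  lengths of independent lists because \<open>dim\<close> has a meaning only for spaces already
  known to be of finite dimension, which then follows.
\<close>

locale filtered_algebra = ring R for R (structure) +
  fixes K :: "'a set" and W :: "nat \<Rightarrow> 'a set" and D :: "nat \<Rightarrow> nat"
  assumes K: "subfield K R"
    and W_subspace: "subalgebra K (W n) R"
    and W_one: "\<one> \<in> W 0"
    and W_mult: "x \<in> W i \<Longrightarrow> y \<in> W j \<Longrightarrow> x \<otimes> y \<in> W (i + j)"
    and W_mono: "i \<le> j \<Longrightarrow> W i \<subseteq> W j"
    and W_exhaustive: "carrier R \<subseteq> (\<Union>n. W n)"
    and W_independent: "independent K Us \<Longrightarrow> set Us \<subseteq> W n \<Longrightarrow> length Us \<le> D n"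
begin

text \<open>
  An independent list of maximal length is a basis.
\<close>

lemma subspace_dimension:
  assumes "subalgebra K E R" and "E \<subseteq> W n"
  obtains k where "k \<le> D n" and "dimension k K E"
proof -
  define P where "P k \<longleftrightarrow> (\<exists>Us. independent K Us \<and> set Us \<subseteq> E \<and> length Us = k)" for k
  have "P 0" by (simp add: P_def)
  moreover have bound: "k \<le> D n" if "P k" for k
    using that W_independent[of _ n] assms(2) by (force simp: P_def)
  ultimately obtain k where k: "P k" "\<And>l. P l \<Longrightarrow> l \<le> k"
    using GreatestI_nat[of P 0 "D n"] Greatest_le_nat[of P _ "D n"] by blast
  then obtain Us where Us: "independent K Us" "set Us \<subseteq> E" "length Us = k" by (auto simp: P_def)
  have "Span K Us = E"
  proof (rule ccontr)
    assume "Span K Us \<noteq> E"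
    then obtain v where v: "v \<in> E" "v \<notin> Span K Us"
      using subalgebra_Span_incl[OF K assms(1) Us(2)] by blast
    then have "independent K (v # Us)"
      using Us(1) subalgebra_in_carrier[OF assms(1)] by (auto intro: li_Cons)
    then have "P (Suc k)" unfolding P_def using v Us by (intro exI[of _ "v # Us"]) auto
    then show False using k(2) by fastforce
  qed
  then show thesis using that[OF bound[OF k(1)]] dimensionI[OF K Us(1)] Us(3) by blast
qed

lemma dim_le:
  assumes "subalgebra K E R" and "E \<subseteq> W n"
  shows "dim K E \<le> D n"
  using subspace_dimension[OF assms] dimI[OF K] by (metis over_def)

lemma length_independent_le_dim:
  assumes "subalgebra K E R" and "E \<subseteq> W n" and "independent K Us" and "set Us \<subseteq> E"
  shows "length Us \<le> dim K E"
  using subspace_dimension[OF assms(1,2)] dimI[OF K] independent_length_le_dimension[OF K _ assms(3,4)]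
  by (metis over_def)

lemma foldr_mult_in_W:
  "set vs \<subseteq> W r \<Longrightarrow> foldr (\<otimes>) vs \<one> \<in> W (r * length vs)"
  using W_one W_mult by (induction vs) auto

lemma foldr_mult_closed: "set vs \<subseteq> carrier R \<Longrightarrow> foldr (\<otimes>) vs \<one> \<in> carrier R"
  by (induction vs) auto

lemma power_sum_subspace:
  assumes "V \<subseteq> carrier R"
  shows "subalgebra K (power_sum K R V n) R"
proof -
  let ?\<W> = "{W. subalgebra K W R \<and> {foldr (\<otimes>) vs \<one> | vs. set vs \<subseteq> V \<and> length vs \<le> n} \<subseteq> W}"
  have "carrier R \<in> ?\<W>"
    using assms foldr_mult_closed carrier_is_subalgebra[OF subfieldE(3)[OF K]] by blast
  then have "subgroup (\<Inter>?\<W>) (add_monoid R)"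
    by (intro add.subgroups_Inter) (auto dest: subalgebra.axioms(1))
  moreover have "k \<otimes> v \<in> \<Inter>?\<W>" if "k \<in> K" "v \<in> \<Inter>?\<W>" for k v
    using that subalgebra.smult_closed by fast
  ultimately show ?thesis
    unfolding power_sum_def subspace_hull_def by (simp add: subalgebra_def subalgebra_axioms_def)
qed

lemma power_sum_le_W:
  assumes "V \<subseteq> W r"
  shows "power_sum K R V n \<subseteq> W (r * n)"
proof -
  have "foldr (\<otimes>) vs \<one> \<in> W (r * n)" if "set vs \<subseteq> V" "length vs \<le> n" for vs
    using foldr_mult_in_W[of vs r] W_mono[of "r * length vs" "r * n"] that assms by auto
  then show ?thesis
    unfolding power_sum_def subspace_hull_def using W_subspace[of "r * n"] by blast
qed

lemma finite_dimension_bounded: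
  assumes "finite_dimension K V"
  obtains r where "V \<subseteq> W r"
proof -
  obtain k where "dimension k K V" using assms by auto
  then obtain Vs where Vs: "set Vs \<subseteq> carrier R" "Span K Vs = V"
    using exists_base[OF K] by blast
  have "\<exists>r. set Vs \<subseteq> W r" using Vs(1)
  proof (induction Vs)
    case (Cons v Vs)
    then obtain r s where "set Vs \<subseteq> W r" "v \<in> W s" using W_exhaustive by auto
    then have "set (v # Vs) \<subseteq> W (max r s)"
      using W_mono[of r "max r s"] W_mono[of s "max r s"] by auto
    then show ?case by blast
  qed auto
  then show thesis using subalgebra_Span_incl[OF K W_subspace] Vs(2) that by blast
qed

text \<open>
  A subspace of finite dimension lies in some \<open>W r\<close>, so its powers up to the
  \<open>n\<close>-th lie in \<open>W (r n)\<close>. The constants \<open>C\<close> and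
  \<open>r\<close> do not affect the limit of the logarithms to base \<open>n\<close>.
\<close>

lemma GKdim_le:
  assumes "C > 0" and "\<And>n. D n \<le> C * (n + 1) ^ d"
  shows "GKdim K R \<le> ereal (real d)"
  unfolding GKdim_def
proof (rule SUP_least)
  fix V assume "V \<in> {V. subalgebra K V R \<and> finite_dimension K V}"
  then have V: "subalgebra K V R" "finite_dimension K V" by auto
  obtain r where r: "V \<subseteq> W r" using finite_dimension_bounded[OF V(2)] .
  let ?dim = "\<lambda>n. dim K (power_sum K R V n)"
  have dim: "real (?dim n) \<le> real C * (real r * real n + 1) ^ d" for n
  proof -
    have "?dim n \<le> D (r * n)"
      using dim_le[OF power_sum_subspace power_sum_le_W[OF r]] subalgebra_in_carrier[OF V(1)] .
    also have "\<dots> \<le> C * (r * n + 1) ^ d" by (rule assms)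
    finally have "real (?dim n) \<le> real (C * (r * n + 1) ^ d)" by (rule of_nat_mono)
    then show ?thesis by (simp add: add.commute)
  qed
  let ?f = "\<lambda>n. (ln (real C) + real d * ln (real r * real n + 1)) / ln (real n)"
  have le: "log (real n) (real (?dim n)) \<le> ?f n" if "n \<ge> 2" for n
  proof -
    have pos: "real r * real n + 1 > 0" by (intro add_nonneg_pos) auto
    have "ln (real (?dim n)) \<le> ln (real C * (real r * real n + 1) ^ d)"
    proof (cases "?dim n = 0")
      case True
      \<comment> \<open>The logarithm of 0 is 0 here, so the bound has to be at least 1.\<close>
      have "1 \<le> real C * (real r * real n + 1) ^ d"
        using assms(1) by (intro mult_ge1_I one_le_power) auto
      then show ?thesis using True by simp
    next
      case False
      then show ?thesis using dim[of n] by (intro ln_mono) auto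
    qed
    also have "\<dots> = ln (real C) + real d * ln (real r * real n + 1)"
      using pos assms(1) by (simp add: ln_mult ln_realpow)
    finally show ?thesis using that by (simp add: log_def divide_right_mono)
  qed
  have lim: "?f \<longlonglongrightarrow> (if r = 0 then 0 else real d)"
  proof (cases "r = 0")
    case True
    then show ?thesis by simp real_asymp
  next
    case False
    then have "real r > 0" by simp
    then show ?thesis using False by simp real_asymp
  qed
  have "limsup (\<lambda>n. ereal (log (real n) (real (?dim n)))) \<le> limsup (\<lambda>n. ereal (?f n))"
    using le by (intro Limsup_mono eventually_sequentiallyI[of 2]) simp
  also have "\<dots> = ereal (if r = 0 then 0 else real d)"
    using lim by (intro lim_imp_Limsup) auto
  finally show "limsup (\<lambda>n. ereal (log (real n) (real (?dim n)))) \<le> ereal (real d)"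
    by (auto split: if_splits intro: order_trans)
qed

text \<open>
  The rounding in \<open>n div d\<close> and the factor \<open>d\<close> cost only a constant
  factor, which disappears in the limit.
\<close>

lemma GKdim_ge:
  assumes "d > 0" and "subalgebra K V R" and "finite_dimension K V"
    and "\<And>n. \<exists>Us. independent K Us \<and> set Us \<subseteq> power_sum K R V n \<and> length Us \<ge> (n div d + 1) ^ d"
  shows "GKdim K R \<ge> ereal (real d)"
proof -
  obtain r where r: "V \<subseteq> W r" using finite_dimension_bounded[OF assms(3)] .
  let ?dim = "\<lambda>n. dim K (power_sum K R V n)"
  let ?f = "\<lambda>n. (real d * (ln (real n) - ln (real d))) / ln (real n)"
  have le: "?f n \<le> log (real n) (real (?dim n))" if "n \<ge> 2" for n
  proof -
    have "(n div d + 1) ^ d \<le> ?dim n"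
    proof -
      obtain Us where Us: "independent K Us" "set Us \<subseteq> power_sum K R V n"
          "(n div d + 1) ^ d \<le> length Us"
        using assms(4) by blast
      note Us(3)
      also have "length Us \<le> ?dim n"
        using length_independent_le_dim[OF power_sum_subspace power_sum_le_W[OF r]]
          subalgebra_in_carrier[OF assms(2)] Us(1,2) by blast
      finally show ?thesis .
    qed
    moreover have "real n / real d \<le> real (n div d + 1)"
    proof -
      have "n \<le> (n div d + 1) * d"
        using assms(1) by (metis add.commute dividend_less_times_div less_imp_le mult.commute mult_Suc_right Suc_eq_plus1)
      then have "real n \<le> real (n div d + 1) * real d" by (metis of_nat_le_iff of_nat_mult)
      then show ?thesis using assms(1) by (simp add: divide_le_eq)
    qed
    ultimately have "(real n / real d) ^ d \<le> real (?dim n)"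
    proof -
      assume dim: "(n div d + 1) ^ d \<le> ?dim n" and le: "real n / real d \<le> real (n div d + 1)"
      have "(real n / real d) ^ d \<le> real (n div d + 1) ^ d"
        using le by (intro power_mono) auto
      also have "\<dots> \<le> real (?dim n)" using dim by (metis of_nat_le_iff of_nat_power)
      finally show ?thesis .
    qed
    then have "ln ((real n / real d) ^ d) \<le> ln (real (?dim n))"
      using that assms(1) by (intro ln_mono) auto
    also have "ln ((real n / real d) ^ d) = real d * (ln (real n) - ln (real d))"
      using that assms(1) by (simp add: ln_realpow ln_div)
    finally show ?thesis using that by (simp add: log_def divide_right_mono)
  qed
  have "?f \<longlonglongrightarrow> real d" by real_asymp
  then have "ereal (real d) = limsup (\<lambda>n. ereal (?f n))"
    by (intro lim_imp_Limsup[symmetric]) auto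
  also have "\<dots> \<le> limsup (\<lambda>n. ereal (log (real n) (real (?dim n))))"
    using le by (intro Limsup_mono eventually_sequentiallyI[of 2]) simp
  also have "\<dots> \<le> GKdim K R"
    unfolding GKdim_def using assms(2,3) by (intro SUP_upper) auto
  finally show ?thesis .
qed

end


section \<open>Relatively free algebras\<close>

lemma (in unital_algebra) function_algebra:
  "unital_algebra (\<lambda>c (F :: 'x \<Rightarrow> 'b) \<phi>. scale c (F \<phi>))"
  by unfold_locales
    (auto simp: fun_eq_iff scale_right_distrib scale_left_distrib scale_mult_left scale_mult_right)

lemma ring_of_type_algebra_simps:
  "carrier ring_of_type_algebra = UNIV" "x \<otimes>\<^bsub>ring_of_type_algebra\<^esub> y = x * y"
  "x \<oplus>\<^bsub>ring_of_type_algebra\<^esub> y = x + y" "\<zero>\<^bsub>ring_of_type_algebra\<^esub> = 0" "\<one>\<^bsub>ring_of_type_algebra\<^esub> = 1"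
  by (simp_all add: ring_of_type_algebra_def)

definition graded_vars :: "nat \<Rightarrow> graded_var set" where
  "graded_vars m = Y ` {1..m} \<union> Z ` {1..m}"

text \<open>
  The filtration of the free algebra by the length of words.
\<close>

definition bounded_polys :: "nat \<Rightarrow> nat \<Rightarrow> (graded_var, 'a::field) free_algebra set" where
  "bounded_polys m n =
    {f. \<forall>w\<in>Poly_Mapping.keys f. set (letters w) \<subseteq> graded_vars m \<and> length (letters w) \<le> n}"

lemma carrier_free_graded_algebra:
  "carrier (free_graded_algebra m :: (graded_var, 'a::field) free_algebra ring)
    = (\<Union>n. bounded_polys m n)"
proof (intro equalityI subsetI)
  fix f :: "(graded_var, 'a) free_algebra" assume f: "f \<in> carrier (free_graded_algebra m)"
  let ?n = "Max ((\<lambda>w. length (letters w)) ` Poly_Mapping.keys f)"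
  have "f \<in> bounded_polys m ?n"
    using f by (auto simp: free_graded_algebra_def bounded_polys_def graded_vars_def)
  then show "f \<in> (\<Union>n. bounded_polys m n)" by blast
qed (auto simp: free_graded_algebra_def bounded_polys_def graded_vars_def)

lemma free_graded_algebra_simps:
  "x \<otimes>\<^bsub>free_graded_algebra m\<^esub> y = x * y" "x \<oplus>\<^bsub>free_graded_algebra m\<^esub> y = x + y"
  "\<zero>\<^bsub>free_graded_algebra m\<^esub> = 0" "\<one>\<^bsub>free_graded_algebra m\<^esub> = 1"
  by (simp_all add: free_graded_algebra_def ring_of_type_algebra_def)

lemma bounded_polys_mono: "i \<le> j \<Longrightarrow> bounded_polys m i \<subseteq> bounded_polys m j"
  by (fastforce simp: bounded_polys_def)

lemma bounded_polys_single:
  "set (letters w) \<subseteq> graded_vars m \<Longrightarrow> length (letters w) \<le> n \<Longrightarrow> Poly_Mapping.single w c \<in> bounded_polys m n"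
  by (auto simp: bounded_polys_def)

lemma bounded_polys_const: "fa_const c \<in> bounded_polys m n"
  unfolding fa_const_def by (rule bounded_polys_single) (auto simp: zero_word_def)

lemma bounded_polys_0: "0 \<in> bounded_polys m n"
  by (simp add: bounded_polys_def)

lemma bounded_polys_1: "1 \<in> bounded_polys m n"
  using bounded_polys_const[of 1] by (simp add: fa_const_def)

lemma bounded_polys_add: "f \<in> bounded_polys m n \<Longrightarrow> g \<in> bounded_polys m n \<Longrightarrow> f + g \<in> bounded_polys m n"
  using Poly_Mapping.keys_add[of f g] unfolding bounded_polys_def by blast

lemma bounded_polys_mult:
  "f \<in> bounded_polys m i \<Longrightarrow> g \<in> bounded_polys m j \<Longrightarrow> f * g \<in> bounded_polys m (i + j)"
  using keys_mult[of f g] by (fastforce simp: bounded_polys_def plus_word_def)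

lemma ring_free_graded_algebra: "ring (free_graded_algebra m :: (graded_var, 'a::field) free_algebra ring)"
proof -
  let ?R = "ring_of_type_algebra :: (graded_var, 'a) free_algebra ring"
  let ?H = "carrier (free_graded_algebra m) :: (graded_var, 'a) free_algebra set"
  interpret ring ?R by (rule ring_of_type_algebra_ring)
  have uminus: "\<ominus>\<^bsub>?R\<^esub> h = - h" for h
    by (rule minus_equality) (simp_all add: ring_of_type_algebra_simps)
  have max: "\<exists>k. f \<in> bounded_polys m k \<and> g \<in> bounded_polys m k"
    if fg: "f \<in> ?H" "g \<in> ?H" for f g
  proof -
    obtain i j where "f \<in> bounded_polys m i" "g \<in> bounded_polys m j"
      using fg by (auto simp: carrier_free_graded_algebra)
    then show ?thesis
      using bounded_polys_mono[of i "max i j" m] bounded_polys_mono[of j "max i j" m] by auto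
  qed
  have "subring ?H ?R"
  proof (rule subringI)
    show "h1 \<otimes>\<^bsub>?R\<^esub> h2 \<in> ?H" "h1 \<oplus>\<^bsub>?R\<^esub> h2 \<in> ?H" if h: "h1 \<in> ?H" "h2 \<in> ?H" for h1 h2
    proof -
      obtain k where k: "h1 \<in> bounded_polys m k" "h2 \<in> bounded_polys m k"
        using max[OF h] by blast
      show "h1 \<otimes>\<^bsub>?R\<^esub> h2 \<in> ?H" "h1 \<oplus>\<^bsub>?R\<^esub> h2 \<in> ?H"
        using bounded_polys_mult[OF k] bounded_polys_add[OF k]
        by (auto simp only: carrier_free_graded_algebra ring_of_type_algebra_simps)
    qed
    show "\<ominus>\<^bsub>?R\<^esub> h \<in> ?H" if "h \<in> ?H" for h
      using that by (simp add: uminus free_graded_algebra_def)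
  qed (auto simp: carrier_free_graded_algebra ring_of_type_algebra_simps bounded_polys_1)
  then have "ring (?R\<lparr>carrier := ?H\<rparr>)" by (rule subring_is_ring)
  moreover have "?R\<lparr>carrier := ?H\<rparr> = free_graded_algebra m" by (simp add: free_graded_algebra_def)
  ultimately show ?thesis by simp
qed

locale graded_algebra = unital_algebra scale
  for scale :: "'a::field \<Rightarrow> 'b::ring_1 \<Rightarrow> 'b" +
  fixes B :: "bit \<Rightarrow> 'b set" and m :: nat
  assumes zero_homogeneous: "0 \<in> B d"
begin

definition admissible :: "(graded_var \<Rightarrow> 'b) \<Rightarrow> bool" where
  "admissible \<phi> \<longleftrightarrow> (\<forall>i. \<phi> (Y i) \<in> B 0 \<and> \<phi> (Z i) \<in> B 1)"

text \<open>
  The substitutions are the points of the function algebra. At an inadmissible one every variable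
  takes the value 0, which is again an admissible substitution, so such points add no condition.
\<close>

definition generic :: "graded_var \<Rightarrow> (graded_var \<Rightarrow> 'b) \<Rightarrow> 'b" where
  "generic v = (\<lambda>\<phi>. if admissible \<phi> then \<phi> v else 0)"

definition fscale :: "'a \<Rightarrow> ((graded_var \<Rightarrow> 'b) \<Rightarrow> 'b) \<Rightarrow> (graded_var \<Rightarrow> 'b) \<Rightarrow> 'b" where
  "fscale c F = (\<lambda>\<phi>. scale c (F \<phi>))"

lemma fscale_apply: "fscale c F \<phi> = scale c (F \<phi>)"
  by (simp add: fscale_def)

sublocale fun_alg: unital_algebra fscale
  using function_algebra unfolding fscale_def[abs_def] .

abbreviation ev :: "(graded_var, 'a) free_algebra \<Rightarrow> (graded_var \<Rightarrow> 'b) \<Rightarrow> 'b" where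
  "ev \<equiv> fa_eval fscale generic"

lemma ev_apply: "ev f \<phi> = fa_eval scale (if admissible \<phi> then \<phi> else (\<lambda>_. 0)) f"
proof (induction f rule: free_algebra_induct)
  case (single w c)
  have "prod_list (map generic vs) \<phi> = prod_list (map (if admissible \<phi> then \<phi> else (\<lambda>_. 0)) vs)" for vs
    by (induction vs) (auto simp: generic_def)
  then have "fscale c (prod_list (map generic (letters w))) \<phi>
      = scale c (prod_list (map (if admissible \<phi> then \<phi> else (\<lambda>_. 0)) (letters w)))"
    by (simp add: fscale_apply)
  then show ?case unfolding fun_alg.fa_eval_single fa_eval_single .
qed simp

lemma ev_eq_0_iff: "ev f = 0 \<longleftrightarrow> (\<forall>\<phi>. admissible \<phi> \<longrightarrow> fa_eval scale \<phi> f = 0)"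
proof -
  have "admissible (\<lambda>_. 0)" using zero_homogeneous by (simp add: admissible_def)
  then show ?thesis by (auto simp: fun_eq_iff ev_apply)
qed

abbreviation "R \<equiv> free_graded_algebra m :: (graded_var, 'a) free_algebra ring"
abbreviation "I \<equiv> relfree_ideal scale B m"
abbreviation "A \<equiv> relfree_algebra scale B m"
abbreviation "K \<equiv> relfree_scalars scale B m"

definition cls :: "(graded_var, 'a) free_algebra \<Rightarrow> (graded_var, 'a) free_algebra set" where
  "cls f = I +>\<^bsub>R\<^esub> f"

lemma relfree_ideal_eq: "I = {f \<in> carrier R. ev f = 0}"
proof -
  have "graded_identities scale B = {f. ev f = 0}"
    unfolding graded_identities_def ev_eq_0_iff admissible_def ..
  then show ?thesis unfolding relfree_ideal_def by blast
qed

sublocale R: ring R by (rule ring_free_graded_algebra)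

text \<open>
  The graded identities are the kernel of evaluation at the generic element.
\<close>

lemma ideal_I: "ideal I R"
proof -
  let ?S = "ring_of_type_algebra :: ((graded_var \<Rightarrow> 'b) \<Rightarrow> 'b) ring"
  have "ev \<in> ring_hom R ?S"
    by (rule ring_hom_memI)
      (simp_all only: ring_of_type_algebra_simps free_graded_algebra_simps UNIV_I
        fun_alg.fa_eval_mult fun_alg.fa_eval_add fun_alg.fa_eval_1)
  then have "ring_hom_ring R ?S ev"
    by (rule ring_hom_ringI2[OF R.ring_axioms ring_of_type_algebra_ring])
  then have "ideal (a_kernel R ?S ev) R" by (rule ring_hom_ring.kernel_is_ideal)
  moreover have "I = a_kernel R ?S ev"
    unfolding relfree_ideal_eq a_kernel_def' ring_of_type_algebra_simps ..
  ultimately show ?thesis by simp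
qed

lemma cls_ring_hom_ring: "ring_hom_ring R A cls"
  using ideal.rcos_ring_hom_ring[OF ideal_I] unfolding cls_def[abs_def] relfree_algebra_def .

sublocale quotient: ring A
  by (rule ring_hom_ring.axioms(2)[OF cls_ring_hom_ring])

lemma carrier_A: "carrier A = cls ` carrier R"
  by (auto simp: relfree_algebra_def FactRing_def A_RCOSETS_def' cls_def)

lemma cls_closed [simp]: "f \<in> carrier R \<Longrightarrow> cls f \<in> carrier A"
  by (simp add: carrier_A)

lemma cls_add: "f \<in> carrier R \<Longrightarrow> g \<in> carrier R \<Longrightarrow> cls (f + g) = cls f \<oplus>\<^bsub>A\<^esub> cls g"
  using ring_hom_add[OF ring_hom_ring.homh[OF cls_ring_hom_ring]]
  by (simp add: free_graded_algebra_simps)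

lemma cls_mult: "f \<in> carrier R \<Longrightarrow> g \<in> carrier R \<Longrightarrow> cls (f * g) = cls f \<otimes>\<^bsub>A\<^esub> cls g"
  using ring_hom_mult[OF ring_hom_ring.homh[OF cls_ring_hom_ring]]
  by (simp add: free_graded_algebra_simps)

lemma cls_0: "cls 0 = \<zero>\<^bsub>A\<^esub>"
  using ring_hom_zero[OF ring_hom_ring.homh[OF cls_ring_hom_ring] R.ring_axioms quotient.ring_axioms]
  by (simp add: free_graded_algebra_simps)

lemma cls_1: "cls 1 = \<one>\<^bsub>A\<^esub>"
  using ring_hom_one[OF ring_hom_ring.homh[OF cls_ring_hom_ring]]
  by (simp add: free_graded_algebra_simps)

lemma cls_eq_0_iff:
  assumes "f \<in> carrier R"
  shows "cls f = \<zero>\<^bsub>A\<^esub> \<longleftrightarrow> ev f = 0"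
proof -
  have "\<zero>\<^bsub>A\<^esub> = I" by (simp add: relfree_algebra_def FactRing_def)
  moreover have "I +>\<^bsub>R\<^esub> f = I \<longleftrightarrow> f \<in> I"
    using ideal.rcos_const_imp_mem[OF ideal_I assms] R.a_rcos_zero[OF ideal_I] by blast
  ultimately show ?thesis using assms by (auto simp: cls_def relfree_ideal_eq)
qed

lemma const_carrier: "fa_const c \<in> carrier R"
  using bounded_polys_const by (auto simp: carrier_free_graded_algebra)

lemma K_eq: "K = range (\<lambda>c. cls (fa_const c))"
  by (simp add: relfree_scalars_def cls_def)

lemma cls_const_eq_0_iff: "cls (fa_const c) = \<zero>\<^bsub>A\<^esub> \<longleftrightarrow> c = 0"
  by (simp add: cls_eq_0_iff const_carrier fscale_def fun_eq_iff)

lemma subfield_K: "subfield K A"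
proof -
  let ?F = "ring_of_type_algebra :: 'a ring"
  have const: "fa_const (c + d) = fa_const c + (fa_const d :: (graded_var, 'a) free_algebra)"
    "fa_const (c * d) = fa_const c * (fa_const d :: (graded_var, 'a) free_algebra)"
    "fa_const 1 = (1 :: (graded_var, 'a) free_algebra)" for c d :: 'a
    by (simp_all add: fa_const_def single_add mult_single)
  have "(\<lambda>c. cls (fa_const c)) \<in> ring_hom ?F A"
    by (rule ring_hom_memI)
      (simp_all add: ring_of_type_algebra_simps const cls_add cls_mult cls_1 const_carrier)
  then interpret h: ring_hom_ring ?F A "\<lambda>c. cls (fa_const c)"
    by (intro ring_hom_ringI2 ring_of_type_algebra_ring quotient.ring_axioms)
  have "subfield (carrier ?F) ?F"
    by (rule field.carrier_is_subfield[OF field_from_type_algebra])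
  moreover have "\<one>\<^bsub>A\<^esub> \<noteq> \<zero>\<^bsub>A\<^esub>"
    using cls_const_eq_0_iff[of 1] by (simp add: const cls_1)
  ultimately show ?thesis
    using h.img_is_subfield(2) by (simp add: K_eq ring_of_type_algebra_simps)
qed

lemma linear_combination_closed:
  assumes "set fs \<subseteq> carrier R" and "length cs = length fs"
  shows "(\<Sum>(c, f)\<leftarrow>zip cs fs. fa_const c * f) \<in> carrier R"
  using assms(2,1)
proof (induction cs fs rule: list_induct2)
  case (Cons c cs f fs)
  then show ?case
    using R.a_closed R.m_closed[OF const_carrier[of c]] by (simp add: free_graded_algebra_simps)
qed (use R.zero_closed in \<open>simp add: free_graded_algebra_simps\<close>)

lemma combine_cls:
  assumes "set fs \<subseteq> carrier R" and "length cs = length fs"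
  shows "quotient.combine (map (\<lambda>c. cls (fa_const c)) cs) (map cls fs)
    = cls (\<Sum>(c, f)\<leftarrow>zip cs fs. fa_const c * f)"
  using assms(2,1)
proof (induction cs fs rule: list_induct2)
  case (Cons c cs f fs)
  have "fa_const c * f \<in> carrier R"
    using Cons R.m_closed[OF const_carrier[of c]] by (simp add: free_graded_algebra_simps)
  then show ?case
    using Cons linear_combination_closed[of fs cs]
    by (simp add: cls_add cls_mult const_carrier)
qed (simp add: cls_0)

lemma ev_linear_combination:
  assumes "length cs = length fs"
  shows "ev (\<Sum>(c, f)\<leftarrow>zip cs fs. fa_const c * f) = (\<Sum>(c, g)\<leftarrow>zip cs (map ev fs). fscale c g)"
  using assms by (induction cs fs rule: list_induct2) (simp_all add: fun_alg.scale_mult_left)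

text \<open>
  Linear independence in the quotient, with scalars from the embedded field, is linear
  independence of evaluation functions over the field itself.
\<close>

lemma independent_cls_iff:
  assumes "set fs \<subseteq> carrier R"
  shows "quotient.independent K (map cls fs) \<longleftrightarrow>
    (\<forall>cs. length cs = length fs \<longrightarrow> (\<Sum>(c, g)\<leftarrow>zip cs (map ev fs). fscale c g) = 0 \<longrightarrow> set cs \<subseteq> {0})"
    (is "?L \<longleftrightarrow> ?P")
proof
  assume ?L
  show ?P
  proof (intro allI impI)
    fix cs assume cs: "length cs = length fs" "(\<Sum>(c, g)\<leftarrow>zip cs (map ev fs). fscale c g) = 0"
    let ?Ks = "map (\<lambda>c. cls (fa_const c)) cs"
    have "quotient.combine ?Ks (map cls fs) = \<zero>\<^bsub>A\<^esub>"
      using cs assms by (simp add: combine_cls cls_eq_0_iff linear_combination_closed ev_linear_combination)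
    then have "set (take (length (map cls fs)) ?Ks) \<subseteq> {\<zero>\<^bsub>A\<^esub>}"
      using quotient.independent_imp_trivial_combine[OF subfield_K \<open>?L\<close>, of ?Ks] by (auto simp: K_eq)
    then show "set cs \<subseteq> {0}" using cs(1) by (auto simp: cls_const_eq_0_iff)
  qed
next
  assume ?P
  show ?L
  proof (rule quotient.trivial_combine_imp_independent[OF subfield_K])
    show clsA: "set (map cls fs) \<subseteq> carrier A" using assms by auto
    fix Ks assume Ks: "set Ks \<subseteq> K" "quotient.combine Ks (map cls fs) = \<zero>\<^bsub>A\<^esub>"
    then have "set Ks \<subseteq> carrier A" using subfieldE(3)[OF subfield_K] by blast
    then obtain Ks' where Ks': "set (take (length (map cls fs)) Ks) \<subseteq> set Ks'"
        "set Ks' \<subseteq> set (take (length (map cls fs)) Ks) \<union> {\<zero>\<^bsub>A\<^esub>}"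
        "length Ks' = length fs" "quotient.combine Ks' (map cls fs) = \<zero>\<^bsub>A\<^esub>"
      using quotient.combine_normalize[OF \<open>set Ks \<subseteq> carrier A\<close> clsA Ks(2)] by (metis length_map)
    have "set Ks' \<subseteq> K"
    proof
      fix k assume "k \<in> set Ks'"
      then consider "k \<in> set Ks" | "k = \<zero>\<^bsub>A\<^esub>" using Ks'(2) by (auto dest: in_set_takeD)
      then show "k \<in> K"
      proof cases
        case 2
        then have "k = cls (fa_const 0)" using cls_const_eq_0_iff[of 0] by simp
        then show ?thesis unfolding K_eq by blast
      qed (use Ks(1) in blast)
    qed
    then have "\<forall>k\<in>set Ks'. \<exists>c. k = cls (fa_const c)" unfolding K_eq by blast
    then obtain cs where cs: "Ks' = map (\<lambda>c. cls (fa_const c)) cs"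
      using ex_map_conv[of Ks' "\<lambda>c. cls (fa_const c)"] by blast
    have "(\<Sum>(c, g)\<leftarrow>zip cs (map ev fs). fscale c g) = 0"
      using Ks'(3,4) assms
      by (simp add: cs combine_cls cls_eq_0_iff linear_combination_closed ev_linear_combination)
    then have "set cs \<subseteq> {0}" using \<open>?P\<close> Ks'(3) by (simp add: cs)
    then show "set (take (length (map cls fs)) Ks) \<subseteq> {\<zero>\<^bsub>A\<^esub>}"
      using Ks'(1) cls_const_eq_0_iff[of 0] by (auto simp: cs)
  qed
qed

text \<open>
  Independent classes of polynomials of length at most \<open>n\<close> have independent
  evaluation functions, which lie in the span of the values of words of length at most
  \<open>n\<close>. A spanning set of \<open>D n\<close> functions thus bounds their number.
\<close>

lemma filtered:
  assumes D: "\<And>n. \<exists>S. finite S \<and> card S \<le> D n \<and>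
    (\<forall>ws. set ws \<subseteq> graded_vars m \<and> length ws \<le> n \<longrightarrow> prod_list (map generic ws) \<in> fun_alg.span S)"
  shows "filtered_algebra A K (\<lambda>n. cls ` bounded_polys m n) D"
proof (rule filtered_algebra.intro[OF quotient.ring_axioms], rule filtered_algebra_axioms.intro)
  have bR: "bounded_polys m n \<subseteq> carrier R" for n by (auto simp: carrier_free_graded_algebra)
  show "subfield K A" by (rule subfield_K)
  show "\<one>\<^bsub>A\<^esub> \<in> cls ` bounded_polys m 0" 
    using imageI[OF bounded_polys_1, of cls m 0] by (simp only: cls_1)
  show "x \<otimes>\<^bsub>A\<^esub> y \<in> cls ` bounded_polys m (i + j)"
    if xy: "x \<in> cls ` bounded_polys m i" "y \<in> cls ` bounded_polys m j" for x y i j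
  proof -
    obtain f g where fg: "x = cls f" "f \<in> bounded_polys m i" "y = cls g" "g \<in> bounded_polys m j"
      using xy by blast
    then have "x \<otimes>\<^bsub>A\<^esub> y = cls (f * g)" using cls_mult[OF subsetD[OF bR fg(2)] subsetD[OF bR fg(4)]] by simp
    then show ?thesis using bounded_polys_mult[OF fg(2,4)] by blast
  qed
  show "cls ` bounded_polys m i \<subseteq> cls ` bounded_polys m j" if "i \<le> j" for i j
    using bounded_polys_mono[OF that] by (rule image_mono)
  show "carrier A \<subseteq> (\<Union>n. cls ` bounded_polys m n)"
    by (auto simp: carrier_A carrier_free_graded_algebra)
  show "subalgebra K (cls ` bounded_polys m n) A" for n
  proof -
    have scalar: "cls (fa_const c) \<otimes>\<^bsub>A\<^esub> x \<in> cls ` bounded_polys m n" if x: "x \<in> cls ` bounded_polys m n" for c x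
    proof -
      obtain f where f: "x = cls f" "f \<in> bounded_polys m n" using x by blast
      then have "cls (fa_const c) \<otimes>\<^bsub>A\<^esub> x = cls (fa_const c * f)"
        using cls_mult[OF const_carrier subsetD[OF bR f(2)]] by simp
      then show ?thesis using bounded_polys_mult[OF bounded_polys_const f(2), of c 0] by auto
    qed
    have "subgroup (cls ` bounded_polys m n) (add_monoid A)"
    proof (rule quotient.add.subgroupI)
      show "cls ` bounded_polys m n \<subseteq> carrier A" using bR by (auto simp: carrier_A)
      show "cls ` bounded_polys m n \<noteq> {}" using bounded_polys_0 by auto
      show "\<ominus>\<^bsub>A\<^esub> x \<in> cls ` bounded_polys m n" if x: "x \<in> cls ` bounded_polys m n" for x
      proof -
        have xA: "x \<in> carrier A" using x bR by (auto simp: carrier_A)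
        have "cls (fa_const (-1)) \<oplus>\<^bsub>A\<^esub> \<one>\<^bsub>A\<^esub> = cls (fa_const (-1) + 1)"
          using cls_add[OF const_carrier, of 1 "-1"] const_carrier[of 1] cls_1 by (simp add: fa_const_def)
        also have "fa_const (-1) + 1 = (0 :: (graded_var, 'a) free_algebra)"
          using single_add[of "0 :: graded_var word" "-1 :: 'a" 1] by (simp add: fa_const_def)
        finally have "cls (fa_const (-1)) \<oplus>\<^bsub>A\<^esub> \<one>\<^bsub>A\<^esub> = \<zero>\<^bsub>A\<^esub>" by (simp add: cls_0)
        then have "cls (fa_const (-1)) \<otimes>\<^bsub>A\<^esub> x \<oplus>\<^bsub>A\<^esub> x = \<zero>\<^bsub>A\<^esub>"
          using xA const_carrier quotient.l_distr[of "cls (fa_const (-1))" "\<one>\<^bsub>A\<^esub>" x] by simp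
        then have "\<ominus>\<^bsub>A\<^esub> x = cls (fa_const (-1)) \<otimes>\<^bsub>A\<^esub> x"
          using xA const_carrier by (intro quotient.minus_equality) auto
        then show ?thesis using scalar[OF x] by simp
      qed
      show "x \<oplus>\<^bsub>A\<^esub> y \<in> cls ` bounded_polys m n"
        if xy: "x \<in> cls ` bounded_polys m n" "y \<in> cls ` bounded_polys m n" for x y
      proof -
        obtain f g where fg: "x = cls f" "f \<in> bounded_polys m n" "y = cls g" "g \<in> bounded_polys m n"
          using xy by blast
        then have "x \<oplus>\<^bsub>A\<^esub> y = cls (f + g)" using cls_add[OF subsetD[OF bR fg(2)] subsetD[OF bR fg(4)]] by simp
        then show ?thesis using bounded_polys_add[OF fg(2,4)] by blast
      qed
    qed
    then show ?thesis
      using scalar by (auto simp: subalgebra_def subalgebra_axioms_def K_eq)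
  qed
  show "length us \<le> D n" if us: "quotient.independent K us" "set us \<subseteq> cls ` bounded_polys m n" for us n
  proof (rule ccontr)
    assume "\<not> length us \<le> D n"
    obtain S where S: "finite S" "card S \<le> D n"
      "\<And>ws. set ws \<subseteq> graded_vars m \<and> length ws \<le> n \<Longrightarrow> prod_list (map generic ws) \<in> fun_alg.span S"
      using D by meson
    from us(2) obtain fs where fs: "us = map cls fs" "set fs \<subseteq> bounded_polys m n"
    proof -
      have "\<forall>u\<in>set us. \<exists>f. u = cls f \<and> f \<in> bounded_polys m n" using us(2) by blast
      then obtain h where h: "\<forall>u\<in>set us. u = cls (h u) \<and> h u \<in> bounded_polys m n" by metis
      have "us = map cls (map h us)" using h by (simp add: map_idI)
      then show thesis using that[of "map h us"] h by auto
    qed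
    have "ev f \<in> fun_alg.span S" if "f \<in> bounded_polys m n" for f
      using that S(3) unfolding fa_eval_def bounded_polys_def
      by (intro fun_alg.span_sum fun_alg.span_scale) auto
    then have "set (map ev fs) \<subseteq> fun_alg.span S" using fs(2) by auto
    moreover have "card S < length (map ev fs)" using fs(1) S(2) \<open>\<not> length us \<le> D n\<close> by simp
    ultimately obtain cs where "length cs = length (map ev fs)"
      "(\<Sum>(c, g)\<leftarrow>zip cs (map ev fs). fscale c g) = 0" "\<exists>c\<in>set cs. c \<noteq> 0"
      using fun_alg.more_vectors_than_generators_dependent[OF S(1)] by blast
    then show False
      using us(1) independent_cls_iff[of fs] fs bR[of n] by auto
  qed
qed

end


section \<open>Independent monomials\<close>

text \<open>
  Reading the values of \<open>\<gamma>\<close> as digits in a large base turns a vector of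
  exponents into a single exponent (Kronecker substitution).
\<close>

lemma digit_weights_exist:
  fixes V :: "'v set"
  assumes "finite V"
  obtains k :: "'v \<Rightarrow> nat" where "inj_on (\<lambda>\<gamma>. \<Sum>v\<in>V. \<gamma> v * k v) (PiE V (\<lambda>_. {..N :: nat}))"
proof -
  have "\<exists>k :: 'v \<Rightarrow> nat. inj_on (\<lambda>\<gamma>. \<Sum>v\<in>V. \<gamma> v * k v) (PiE V (\<lambda>_. {..N}))"
    using assms
  proof (induction V)
    case (insert x V)
    then obtain k where k: "inj_on (\<lambda>\<gamma>. \<Sum>v\<in>V. \<gamma> v * k v) (PiE V (\<lambda>_. {..N}))" by blast
    \<comment> \<open>The weight of the new variable exceeds every sum over the old ones.\<close>
    define M where "M = Suc (\<Sum>v\<in>V. N * k v)"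
    define k' where "k' = k(x := M)"
    have sum: "(\<Sum>v\<in>insert x V. \<gamma> v * k' v) = (\<Sum>v\<in>V. \<gamma> v * k v) + \<gamma> x * M" for \<gamma>
    proof -
      have "(\<Sum>v\<in>V. \<gamma> v * k' v) = (\<Sum>v\<in>V. \<gamma> v * k v)"
        using insert.hyps by (intro sum.cong) (auto simp: k'_def)
      then show ?thesis using insert.hyps by (simp add: k'_def)
    qed
    have less: "(\<Sum>v\<in>V. \<gamma> v * k v) < M" if "\<gamma> \<in> PiE (insert x V) (\<lambda>_. {..N})" for \<gamma>
      unfolding M_def less_Suc_eq_le using that by (intro sum_mono mult_right_mono) auto
    have "inj_on (\<lambda>\<gamma>. \<Sum>v\<in>insert x V. \<gamma> v * k' v) (PiE (insert x V) (\<lambda>_. {..N}))"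
    proof (rule inj_onI)
      fix \<gamma> \<delta> assume \<gamma>: "\<gamma> \<in> PiE (insert x V) (\<lambda>_. {..N})" and \<delta>: "\<delta> \<in> PiE (insert x V) (\<lambda>_. {..N})"
        and eq: "(\<Sum>v\<in>insert x V. \<gamma> v * k' v) = (\<Sum>v\<in>insert x V. \<delta> v * k' v)"
      have "\<gamma> x = \<delta> x"
        using arg_cong[OF eq, of "\<lambda>s. s div M"] less[OF \<gamma>] less[OF \<delta>] by (simp add: sum)
      moreover have "(\<Sum>v\<in>V. \<gamma> v * k v) = (\<Sum>v\<in>V. \<delta> v * k v)"
        using arg_cong[OF eq, of "\<lambda>s. s mod M"] less[OF \<gamma>] less[OF \<delta>] by (simp add: sum)
      then have "(\<Sum>v\<in>V. restrict \<gamma> V v * k v) = (\<Sum>v\<in>V. restrict \<delta> V v * k v)" by simp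
      then have "restrict \<gamma> V = restrict \<delta> V"
        using \<gamma> \<delta> by (intro inj_onD[OF k]) auto
      ultimately have "\<gamma> v = \<delta> v" if "v \<in> insert x V" for v
        using that by (auto simp: restrict_def fun_eq_iff dest: spec[of _ v] split: if_splits)
      then show "\<gamma> = \<delta>" using \<gamma> \<delta> by (intro PiE_ext) auto
    qed
    then show ?case by blast
  qed (auto simp: inj_on_def)
  then show thesis using that by blast
qed

lemma commutes_with_mult:
  fixes x y z :: "'b::semigroup_mult"
  assumes "x * y = y * x" and "x * z = z * x"
  shows "x * (y * z) = y * z * x"
  using assms by (metis mult.assoc)

lemma prod_list_map_power_add:
  fixes u :: "'v \<Rightarrow> 'b::monoid_mult"
  assumes "\<And>v w. v \<in> set vs \<Longrightarrow> w \<in> set vs \<Longrightarrow> u v * u w = u w * u v"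
  shows "prod_list (map (\<lambda>v. u v ^ (\<gamma> v + \<delta> v)) vs)
    = prod_list (map (\<lambda>v. u v ^ \<gamma> v) vs) * prod_list (map (\<lambda>v. u v ^ \<delta> v) vs)"
  using assms
proof (induction vs)
  case (Cons w vs)
  have 1: "u w ^ j * u v ^ i = u v ^ i * u w ^ j" if "v \<in> set vs" for v i j
  proof -
    have "u w * u v = u v * u w" using Cons.prems that by simp
    from power_commuting_commutes[OF power_commuting_commutes[OF this, of j, symmetric], of i]
    show ?thesis by simp
  qed
  have 2: "u w ^ j * prod_list (map (\<lambda>v. u v ^ \<gamma> v) ws) = prod_list (map (\<lambda>v. u v ^ \<gamma> v) ws) * u w ^ j"
    if "set ws \<subseteq> set vs" for ws j
    using that
  proof (induction ws)
    case (Cons v ws)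
    then show ?case using commutes_with_mult[OF 1[of v j "\<gamma> v"]] by simp
  qed simp
  have "u w ^ \<delta> w * prod_list (map (\<lambda>v. u v ^ \<gamma> v) vs) = prod_list (map (\<lambda>v. u v ^ \<gamma> v) vs) * u w ^ \<delta> w"
    by (rule 2) simp
  note comm = this
  have "u w ^ \<gamma> w * u w ^ \<delta> w * (prod_list (map (\<lambda>v. u v ^ \<gamma> v) vs) * y)
      = u w ^ \<gamma> w * prod_list (map (\<lambda>v. u v ^ \<gamma> v) vs) * (u w ^ \<delta> w * y)" for y
    using arg_cong[OF comm, of "\<lambda>z. z * y"] by (simp add: mult.assoc)
  then show ?case using Cons.IH Cons.prems by (simp add: power_add)
qed simp

context graded_algebra
begin

definition power_word :: "graded_var list \<Rightarrow> (graded_var \<Rightarrow> nat) \<Rightarrow> graded_var list" where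
  "power_word vs \<gamma> = concat (map (\<lambda>v. replicate (\<gamma> v) v) vs)"

abbreviation "monomial (ws :: graded_var list) \<equiv> Poly_Mapping.single (Word ws) (1 :: 'a)"

lemma prod_list_power_word:
  fixes \<phi> :: "graded_var \<Rightarrow> 'c::monoid_mult"
  shows "prod_list (map \<phi> (power_word vs \<gamma>)) = prod_list (map (\<lambda>v. \<phi> v ^ \<gamma> v) vs)"
  by (induction vs) (simp_all add: power_word_def map_concat prod_list_replicate)

lemma length_power_word_le:
  assumes "\<And>v. v \<in> set vs \<Longrightarrow> \<gamma> v \<le> N"
  shows "length (power_word vs \<gamma>) \<le> N * length vs"
  using assms by (induction vs) (auto simp: power_word_def add_mono)

lemma set_power_word: "set (power_word vs \<gamma>) \<subseteq> set vs"
  by (auto simp: power_word_def)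

lemma prod_list_scale:
  "prod_list (map (\<lambda>v. scale (c v) (x v)) vs) = scale (\<Prod>v\<leftarrow>vs. c v) (prod_list (map x vs))"
  by (induction vs) (simp_all add: scale_mult_left scale_mult_right mult.commute)

lemma monomial_carrier: "set ws \<subseteq> graded_vars m \<Longrightarrow> monomial ws \<in> carrier R"
  using bounded_polys_single[of "Word ws" m "length ws" 1] by (auto simp: carrier_free_graded_algebra)

text \<open>
  After the substitution of \<open>s\<^bsup>k v\<^esup> u v\<close> for \<open>v\<close>, a linear
  relation between the monomials becomes a polynomial in \<open>s\<close> whose coefficients are
  multiples of the products of the \<open>u v ^ \<gamma> v\<close>. None of these products is 0,
  as each divides the one with all exponents equal to \<open>N\<close>.
\<close>

lemma independent_power_words:
  assumes "infinite (UNIV :: 'a set)"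
    and vs: "distinct vs" "set vs \<subseteq> graded_vars m"
    and scaling: "\<And>\<phi> c. admissible \<phi> \<Longrightarrow> admissible (\<lambda>v. scale (c v) (\<phi> v))"
    and "admissible u"
    and comm: "\<And>v w. v \<in> set vs \<Longrightarrow> w \<in> set vs \<Longrightarrow> u v * u w = u w * u v"
    and nz: "prod_list (map (\<lambda>v. u v ^ N) vs) \<noteq> 0"
    and gs: "distinct gs" "set gs = PiE (set vs) (\<lambda>_. {..N})"
  shows "quotient.independent K (map (\<lambda>\<gamma>. cls (monomial (power_word vs \<gamma>))) gs)"
proof -
  obtain k where k: "inj_on (\<lambda>\<gamma>. \<Sum>v\<in>set vs. \<gamma> v * k v) (PiE (set vs) (\<lambda>_. {..N}))"
    using digit_weights_exist[of "set vs" N] by auto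
  let ?e = "\<lambda>\<gamma>. \<Sum>v\<in>set vs. \<gamma> v * k v"
  let ?U = "\<lambda>\<gamma>. prod_list (map (\<lambda>v. u v ^ \<gamma> v) vs)"
  define fs where "fs = map (\<lambda>\<gamma>. monomial (power_word vs \<gamma>)) gs"
  have len: "length fs = length gs" by (simp add: fs_def)
  have fs: "set fs \<subseteq> carrier R"
  proof -
    have "monomial (power_word vs \<gamma>) \<in> carrier R" for \<gamma>
      by (rule monomial_carrier[OF order_trans[OF set_power_word vs(2)]])
    then show ?thesis unfolding fs_def by auto
  qed
  have U: "?U \<gamma> \<noteq> 0" if "\<gamma> \<in> PiE (set vs) (\<lambda>_. {..N})" for \<gamma>
  proof
    assume "?U \<gamma> = 0"
    have "map (\<lambda>v. u v ^ N) vs = map (\<lambda>v. u v ^ (\<gamma> v + (N - \<gamma> v))) vs"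
      using that by (auto simp: PiE_iff)
    then have "prod_list (map (\<lambda>v. u v ^ N) vs) = ?U \<gamma> * ?U (\<lambda>v. N - \<gamma> v)"
      using prod_list_map_power_add[OF comm, where \<gamma>=\<gamma> and \<delta>="\<lambda>v. N - \<gamma> v"] by (simp only:)
    then show False using nz \<open>?U \<gamma> = 0\<close> by simp
  qed
  have "set cs \<subseteq> {0}" if cs: "length cs = length fs" "(\<Sum>(c, g)\<leftarrow>zip cs (map ev fs). fscale c g) = 0" for cs
  proof -
    have ev0: "ev (\<Sum>(c, f)\<leftarrow>zip cs fs. fa_const c * f) = 0"
      using cs by (simp add: ev_linear_combination)
    have zero: "(\<Sum>j<length gs. scale (s ^ ?e (gs ! j)) (scale (cs ! j) (?U (gs ! j)))) = 0" for s
    proof -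
      define \<phi> where "\<phi> v = scale (s ^ k v) (u v)" for v
      have "admissible \<phi>" unfolding \<phi>_def[abs_def] by (rule scaling[OF \<open>admissible u\<close>])
      have eval: "fa_eval scale \<phi> (monomial (power_word vs \<gamma>)) = scale (s ^ ?e \<gamma>) (?U \<gamma>)" for \<gamma>
      proof -
        have "(\<Prod>v\<leftarrow>vs. (s ^ k v) ^ \<gamma> v) = s ^ ?e \<gamma>"
          using vs(1) by (simp add: prod.distinct_set_conv_list[symmetric] power_sum power_mult[symmetric] mult.commute)
        then show ?thesis
          by (simp add: prod_list_power_word \<phi>_def scale_power prod_list_scale)
      qed
      have "fa_eval scale \<phi> (\<Sum>(c, f)\<leftarrow>zip cs fs. fa_const c * f)
          = (\<Sum>(c, \<gamma>)\<leftarrow>zip cs gs. scale c (scale (s ^ ?e \<gamma>) (?U \<gamma>)))"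
        unfolding fs_def using cs(1)[unfolded fs_def length_map]
        by (induction cs gs rule: list_induct2) (simp_all add: eval scale_mult_left del: fa_eval_single)
      also have "\<dots> = (\<Sum>j<length gs. scale (s ^ ?e (gs ! j)) (scale (cs ! j) (?U (gs ! j))))"
        using cs(1) len by (auto simp: sum_list_sum_nth atLeast0LessThan mult.commute intro!: sum.cong)
      finally show ?thesis using ev0 \<open>admissible \<phi>\<close> by (simp add: ev_eq_0_iff)
    qed
    have "cs ! j = 0" if j: "j < length gs" for j
    proof -
      have mem: "gs ! i \<in> PiE (set vs) (\<lambda>_. {..N})" if "i < length gs" for i
        using gs(2) that nth_mem by blast
      have "inj_on (\<lambda>j. ?e (gs ! j)) {..<length gs}"
        using inj_on_eq_iff[OF k mem mem] gs(1) by (auto simp: inj_on_def nth_eq_iff_index_eq)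
      then have "scale (cs ! j) (?U (gs ! j)) = 0"
        using coefficients_zero_if_polynomial_function_zero[OF assms(1) _ zero] j by blast
      then show ?thesis using U[OF mem[OF j]] by simp
    qed
    then show ?thesis using cs(1) len by (auto simp: in_set_conv_nth)
  qed
  then have "quotient.independent K (map cls fs)"
    using independent_cls_iff[OF fs] by blast
  then show ?thesis by (simp add: fs_def comp_def)
qed

lemma foldr_cls_vars:
  assumes "set ws \<subseteq> graded_vars m"
  shows "foldr (\<otimes>\<^bsub>A\<^esub>) (map (\<lambda>v. cls (fa_var v)) ws) \<one>\<^bsub>A\<^esub> = cls (monomial ws)"
  using assms
proof (induction ws)
  case Nil
  have "monomial ([] :: graded_var list) = 1"
    unfolding zero_word_def[symmetric] by (rule single_one)
  then show ?case by (simp add: cls_1)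
next
  case (Cons v ws)
  have "fa_var v * monomial ws = monomial (v # ws)"
    by (simp add: fa_var_def mult_single plus_word_def)
  moreover have "cls (fa_var v * monomial ws) = cls (fa_var v) \<otimes>\<^bsub>A\<^esub> cls (monomial ws)"
    using monomial_carrier[of "[v]"] monomial_carrier[of ws] Cons.prems
    by (intro cls_mult) (simp_all add: fa_var_def)
  ultimately show ?case using Cons by simp
qed

lemma graded_GKdim_le:
  assumes "C > 0" and "\<And>n. \<exists>S. finite S \<and> card S \<le> C * (n + 1) ^ d \<and>
    (\<forall>ws. set ws \<subseteq> graded_vars m \<and> length ws \<le> n \<longrightarrow> prod_list (map generic ws) \<in> fun_alg.span S)"
  shows "graded_GKdim scale B m \<le> ereal (real d)"
  unfolding graded_GKdim_def
  using filtered_algebra.GKdim_le[OF filtered[of "\<lambda>n. C * (n + 1) ^ d", OF assms(2)] assms(1)] by simp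

text \<open>
  The subspace spanned by the variables in \<open>vs\<close> already has this growth: its
  \<open>n\<close>-th power sum contains the \<open>(N + 1)\<^bsup>length vs\<^esup>\<close>
  independent ordered monomials with exponents at most \<open>N = n div length vs\<close>.
\<close>

lemma graded_GKdim_ge:
  assumes "infinite (UNIV :: 'a set)"
    and finite_growth: "\<And>n. \<exists>S. finite S \<and> card S \<le> D n \<and>
      (\<forall>ws. set ws \<subseteq> graded_vars m \<and> length ws \<le> n \<longrightarrow> prod_list (map generic ws) \<in> fun_alg.span S)"
    and vs: "distinct vs" "set vs \<subseteq> graded_vars m" "vs \<noteq> []"
    and scaling: "\<And>\<phi> c. admissible \<phi> \<Longrightarrow> admissible (\<lambda>v. scale (c v) (\<phi> v))"
    and u: "\<And>N. \<exists>u. admissible u \<and> (\<forall>v\<in>set vs. \<forall>w\<in>set vs. u v * u w = u w * u v) \<and>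
      prod_list (map (\<lambda>v. u v ^ N) vs) \<noteq> 0"
  shows "graded_GKdim scale B m \<ge> ereal (real (length vs))"
proof -
  let ?gens = "map (\<lambda>v. cls (fa_var v)) vs"
  define V where "V = quotient.Span K ?gens"
  have gens: "set ?gens \<subseteq> carrier A"
    using monomial_carrier[of "[_]"] vs(2) by (auto simp: carrier_A fa_var_def)
  interpret F: filtered_algebra A K "\<lambda>n. cls ` bounded_polys m n" D
    by (rule filtered[OF finite_growth])
  have "ereal (real (length vs)) \<le> GKdim K A"
  proof (rule F.GKdim_ge)
    show "0 < length vs" using vs(3) by simp
    show "subalgebra K V A" unfolding V_def
      by (rule quotient.Span_is_subalgebra[OF subfield_K gens])
    show "quotient.finite_dimension K V" unfolding V_def
      by (rule quotient.Span_finite_dimension[OF subfield_K gens])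
    fix n
    \<comment> \<open>With this bound on each exponent the words have length at most \<open>n\<close>.\<close>
    let ?N = "n div length vs"
    have fin: "finite (PiE (set vs) (\<lambda>_. {..?N}))" by (intro finite_PiE) auto
    obtain gs where gs: "distinct gs" "set gs = PiE (set vs) (\<lambda>_. {..?N})"
      using finite_distinct_list[OF fin] by blast
    let ?us = "map (\<lambda>\<gamma>. cls (monomial (power_word vs \<gamma>))) gs"
    obtain u where u: "admissible u" "\<And>v w. v \<in> set vs \<Longrightarrow> w \<in> set vs \<Longrightarrow> u v * u w = u w * u v"
        "prod_list (map (\<lambda>v. u v ^ ?N) vs) \<noteq> 0"
      using u by blast
    have "quotient.independent K ?us"
      by (rule independent_power_words[OF assms(1) vs(1,2) scaling u gs])
    moreover have "set ?us \<subseteq> power_sum K A V n"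
    proof
      fix x assume "x \<in> set ?us"
      then obtain \<gamma> where \<gamma>: "\<gamma> \<in> PiE (set vs) (\<lambda>_. {..?N})" "x = cls (monomial (power_word vs \<gamma>))"
        using gs(2) by auto
      let ?ws = "map (\<lambda>v. cls (fa_var v)) (power_word vs \<gamma>)"
      have "length (power_word vs \<gamma>) \<le> ?N * length vs"
        using \<gamma>(1) by (intro length_power_word_le) (auto simp: PiE_iff)
      also have "\<dots> \<le> n" by (rule div_times_less_eq_dividend)
      finally have "length ?ws \<le> n" by simp
      moreover have "set ?ws \<subseteq> V"
        using quotient.Span_base_incl[OF subfield_K gens] set_power_word[of vs \<gamma>]
        unfolding V_def by auto
      moreover have "x = foldr (\<otimes>\<^bsub>A\<^esub>) ?ws \<one>\<^bsub>A\<^esub>"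
        using foldr_cls_vars[of "power_word vs \<gamma>"] set_power_word[of vs \<gamma>] vs(2) \<gamma>(2) by auto
      ultimately show "x \<in> power_sum K A V n"
        unfolding power_sum_def subspace_hull_def by blast
    qed
    moreover have "length ?us = (?N + 1) ^ length vs"
    proof -
      have "length gs = card (PiE (set vs) (\<lambda>_. {..?N}))"
        using distinct_card[OF gs(1)] gs(2) by simp
      then show ?thesis using distinct_card[OF vs(1)] by (simp add: card_PiE)
    qed
    ultimately show "\<exists>Us. quotient.independent K Us \<and> set Us \<subseteq> power_sum K A V n \<and>
        (n div length vs + 1) ^ length vs \<le> length Us"
      by (intro exI[of _ ?us]) simp
  qed
  then show ?thesis by (simp add: graded_GKdim_def)
qed

end


section \<open>The algebra \<open>E\<^sub>\<infinity>\<close>\<close>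

global_interpretation grassmann_graded: graded_algebra "grassmann_scale :: 'a::field \<Rightarrow> _" E_inf_component m for m :: nat
  by unfold_locales (simp add: E_inf_component_def grassmann.span_zero)

fun var_degree :: "graded_var \<Rightarrow> bit" where
  "var_degree (Y i) = 0"
| "var_degree (Z i) = 1"

text \<open>
  The generic elements split into their even and odd parts; the splitting is chosen separately at
  every point, which suffices as the relations between the parts hold pointwise.
\<close>

lemma E_inf_growth:
  assumes two: "(2 :: 'a::field) \<noteq> 0" and "S \<subseteq> graded_vars m" and "q > 0"
    and q: "\<And>v (a :: 'a grassmann). v \<in> graded_vars m - S \<Longrightarrow> a \<in> even_part (var_degree v) \<Longrightarrow> a ^ q = 0"
  obtains C where "C > 0"
    and "\<And>n. \<exists>T. finite T \<and> card T \<le> C * (n + 1) ^ card S \<and>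
      (\<forall>ws. set ws \<subseteq> graded_vars m \<and> length ws \<le> n \<longrightarrow>
        prod_list (map grassmann_graded.generic ws) \<in> grassmann_graded.fun_alg.span (T :: ((graded_var \<Rightarrow> 'a grassmann) \<Rightarrow> 'a grassmann) set))"
proof -
  have "\<exists>a b. grassmann_graded.generic v \<phi> = a + b \<and> a \<in> even_part (var_degree v) \<and> b \<in> odd_part (var_degree v)"
    for v and \<phi> :: "graded_var \<Rightarrow> 'a grassmann"
  proof -
    have "grassmann_graded.generic v \<phi> \<in> E_inf_component (var_degree v)"
      by (cases v) (auto simp: grassmann_graded.generic_def grassmann_graded.admissible_def
          grassmann_graded.zero_homogeneous)
    then show ?thesis by (blast elim: E_inf_component_parity)
  qed
  then obtain a b :: "graded_var \<Rightarrow> (graded_var \<Rightarrow> 'a grassmann) \<Rightarrow> 'a grassmann"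
    where ab: "\<And>v \<phi>. grassmann_graded.generic v \<phi> = a v \<phi> + b v \<phi>"
      "\<And>v \<phi>. a v \<phi> \<in> even_part (var_degree v)" "\<And>v \<phi>. b v \<phi> \<in> odd_part (var_degree v)"
    by metis
  have pow: "(F ^ k) \<phi> = F \<phi> ^ k" for F :: "(graded_var \<Rightarrow> 'a grassmann) \<Rightarrow> 'a grassmann" and k \<phi>
    by (induction k) simp_all
  have fin: "finite (graded_vars m)" by (simp add: graded_vars_def)
  show thesis
  proof (rule grassmann_graded.fun_alg.span_words_supercommuting[OF fin \<open>S \<subseteq> _\<close> \<open>q > 0\<close>,
        where x = grassmann_graded.generic and a = a and b = b])
    show "grassmann_graded.generic v = a v + b v" for v
      using ab(1) by (simp add: fun_eq_iff)
    show "a v * a w = a w * a v" for v w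
      using even_part_commute(1)[OF ab(2,2)] by (simp add: fun_eq_iff)
    show "a v * b w = b w * a v" for v w
      using even_part_commute(2)[OF ab(2,3)] by (simp add: fun_eq_iff)
    show "b v * b w = - (b w * b v)" for v w
      by (rule ext, simp only: times_fun_apply fun_Compl_def) (rule odd_part_anticommute[OF ab(3,3)])
    show "b v * b v = 0" for v
      using odd_part_square[OF two ab(3)] by (simp add: fun_eq_iff)
    show "a v ^ q = 0" if "v \<in> graded_vars m - S" for v
      using q[OF that ab(2)] by (simp add: fun_eq_iff pow)
  qed (rule that)
qed

lemma E_inf_admissible_scale:
  "grassmann_graded.admissible \<phi> \<Longrightarrow> grassmann_graded.admissible (\<lambda>v. grassmann_scale (c v) (\<phi> v :: 'a::field grassmann))"
  by (auto simp: grassmann_graded.admissible_def E_inf_component_def intro: grassmann.span_scale)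

lemma one_E_inf_component: "1 \<in> E_inf_component 0"
proof -
  have "E_inf_degree 0 = 0" by (simp add: E_inf_degree_def zero_word_def)
  then have "grassmann_monomial 0 \<in> E_inf_component 0"
    unfolding E_inf_component_def by (blast intro: grassmann.span_base)
  then show ?thesis by (simp add: grassmann_monomial_0)
qed

text \<open>
  In the numbering from 1, the product of \<open>e\<close> with the odd index \<open>2 l +
  1\<close> and of its even successor: it has degree 1, is central, and outside characteristic 2
  squares to zero.
\<close>

definition generator_pair :: "nat \<Rightarrow> 'a::field grassmann" where
  "generator_pair l = grassmann_monomial (Word [2 * l, 2 * l + 1])"

lemma generator_pair_E_inf_component: "generator_pair l \<in> E_inf_component 1"
proof -
  have "E_inf_degree (Word [2 * l, 2 * l + 1]) = 1" by (simp add: E_inf_degree_def)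
  then show ?thesis
    unfolding E_inf_component_def generator_pair_def by (blast intro: grassmann.span_base)
qed

lemma generator_pair_commute: "generator_pair k * generator_pair l = (generator_pair l * generator_pair k :: 'a::field grassmann)"
  using grassmann_monomial_commute[of "Word [2 * k, 2 * k + 1]" "Word [2 * l, 2 * l + 1]", where 'a = 'a]
  by (simp add: generator_pair_def)

lemma prod_list_generator_pair:
  "prod_list (map generator_pair [j..<k]) = (grassmann_monomial (Word [2 * j..<2 * k]) :: 'a::field grassmann)"
proof (induction k)
  case 0
  show ?case using grassmann_monomial_0[where 'a = 'a] by (simp add: zero_word_def)
next
  case (Suc k)
  show ?case
  proof (cases "j \<le> k")
    case True
    then have "[2 * j..<2 * Suc k] = [2 * j..<2 * k] @ [2 * k, 2 * k + 1]" by simp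
    then show ?thesis using Suc True by (simp add: generator_pair_def grassmann_monomial_mult plus_word_def)
  next
    case False
    then show ?thesis using grassmann_monomial_0[where 'a = 'a] by (simp add: zero_word_def)
  qed
qed

text \<open>
  Different \<open>i\<close> use disjoint sets of generators.
\<close>

definition block_sum :: "nat \<Rightarrow> nat \<Rightarrow> 'a::field grassmann" where
  "block_sum N i = (\<Sum>l\<leftarrow>[i * N..<Suc i * N]. generator_pair l)"

lemma block_sum_E_inf_component: "block_sum N i \<in> E_inf_component 1"
proof -
  have "(\<Sum>l\<leftarrow>ls. generator_pair l) \<in> E_inf_component 1" for ls
    using generator_pair_E_inf_component unfolding E_inf_component_def
    by (induction ls) (auto intro: grassmann.span_add grassmann.span_zero)
  then show ?thesis by (simp add: block_sum_def)
qed

lemma block_sum_commute: "block_sum N i * block_sum N j = (block_sum N j * block_sum N i :: 'a::field grassmann)"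
proof -
  have 1: "generator_pair k * (\<Sum>l\<leftarrow>ls. generator_pair l) = (\<Sum>l\<leftarrow>ls. generator_pair l) * (generator_pair k :: 'a grassmann)" for k ls
    by (induction ls) (simp_all add: distrib_left distrib_right generator_pair_commute[of k])
  have "(\<Sum>k\<leftarrow>ks. generator_pair k) * (\<Sum>l\<leftarrow>ls. generator_pair l) = (\<Sum>l\<leftarrow>ls. generator_pair l) * (\<Sum>k\<leftarrow>ks. generator_pair k :: 'a grassmann)" for ks ls
    by (induction ks) (simp_all add: distrib_left distrib_right 1)
  then show ?thesis by (simp add: block_sum_def)
qed

lemma block_sum_power:
  assumes "(2 :: 'a::field) \<noteq> 0"
  shows "block_sum N i ^ N = grassmann_scale (of_nat (fact N))
    (grassmann_monomial (Word [2 * (i * N)..<2 * (Suc i * N)]) :: 'a grassmann)"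
proof -
  let ?qs = "map generator_pair [i * N..<Suc i * N] :: 'a grassmann list"
  have "sum_list ?qs ^ length ?qs = of_nat (fact (length ?qs)) * prod_list ?qs"
  proof (rule power_sum_list_square_zero)
    show "x * y = y * x" if "x \<in> set ?qs" "y \<in> set ?qs" for x y
      using that by (auto simp: generator_pair_commute)
    show "x * x = 0" if "x \<in> set ?qs" for x
      using that grassmann_monomial_square[OF assms] by (auto simp: generator_pair_def)
  qed
  then show ?thesis
    by (simp only: prod_list_generator_pair block_sum_def of_nat_grassmann[of "fact _"] grassmann_algebra.scale_mult_left)
      simp
qed

text \<open>
  The product is \<open>(N!)\<^sup>k\<close> times the monomial in the first \<open>2 k N\<close>
  generators.
\<close>

lemma prod_block_sum_power_nonzero:
  assumes "CHAR('a::field) = 0"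
  shows "prod_list (map (\<lambda>i. block_sum N i ^ N) [0..<k]) \<noteq> (0 :: 'a grassmann)"
proof -
  have two: "(2 :: 'a) \<noteq> 0"
    using of_nat_eq_0_iff_char_dvd[of 2, where 'a = 'a] assms by simp
  have "prod_list (map (\<lambda>i. block_sum N i ^ N) [0..<k]) = grassmann_scale (of_nat (fact N) ^ k)
      (grassmann_monomial (Word [0..<2 * (k * N)]) :: 'a grassmann)"
  proof (induction k)
    case 0
    show ?case using grassmann_monomial_0[where 'a = 'a] by (simp add: zero_word_def)
  next
    case (Suc k)
    have "[0..<2 * (Suc k * N)] = [0..<2 * (k * N)] @ [2 * (k * N)..<2 * (Suc k * N)]"
      using upt_add_eq_append[of 0 "2 * (k * N)" "2 * N"] by (simp add: algebra_simps)
    then show ?case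
      using Suc by (simp add: block_sum_power[OF two] grassmann_algebra.scale_mult_left
        grassmann_algebra.scale_mult_right grassmann_monomial_mult plus_word_def mult.commute)
  qed
  moreover have "of_nat (fact N) \<noteq> (0 :: 'a)"
    using of_nat_eq_0_iff_char_dvd[of "fact N", where 'a = 'a] assms by simp
  moreover have "grassmann_monomial (Word [0..<2 * (k * N)]) \<noteq> (0 :: 'a grassmann)"
    by (rule grassmann_monomial_distinct) simp
  ultimately show ?thesis by simp
qed

lemma card_graded_vars: "card (graded_vars m) = 2 * m"
proof -
  have "card (graded_vars m) = card (Y ` {1..m}) + card (Z ` {1..m})"
    unfolding graded_vars_def by (rule card_Un_disjoint) auto
  then show ?thesis by (simp add: card_image inj_on_def)
qed

lemma graded_GKdim_E_inf_char_0:
  assumes "m \<ge> 1" and "CHAR('a::field) = 0" and inf: "infinite (UNIV :: 'a set)"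
  shows "graded_GKdim (grassmann_scale :: 'a \<Rightarrow> _) E_inf_component m = ereal (real (2 * m))"
proof (rule antisym)
  have two: "(2 :: 'a) \<noteq> 0"
    using of_nat_eq_0_iff_char_dvd[of 2, where 'a = 'a] assms(2) by simp
  obtain C where C: "C > 0"
    "\<And>n. \<exists>T. finite T \<and> card T \<le> C * (n + 1) ^ card (graded_vars m) \<and>
      (\<forall>ws. set ws \<subseteq> graded_vars m \<and> length ws \<le> n \<longrightarrow>
        prod_list (map grassmann_graded.generic ws) \<in> grassmann_graded.fun_alg.span (T :: ((graded_var \<Rightarrow> 'a grassmann) \<Rightarrow> 'a grassmann) set))"
    using E_inf_growth[OF two, of "graded_vars m" m 1] by auto
  show "graded_GKdim (grassmann_scale :: 'a \<Rightarrow> _) E_inf_component m \<le> ereal (real (2 * m))"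
    using grassmann_graded.graded_GKdim_le[OF C] by (simp only: card_graded_vars)
  let ?vs = "map Y [1..<Suc m] @ map Z [1..<Suc m]"
  have "ereal (real (length ?vs)) \<le> graded_GKdim (grassmann_scale :: 'a \<Rightarrow> _) E_inf_component m"
  proof (rule grassmann_graded.graded_GKdim_ge[OF inf C(2)])
    show "distinct ?vs" by (auto simp: distinct_map inj_on_def)
    show "set ?vs \<subseteq> graded_vars m" by (auto simp: graded_vars_def)
    show "?vs \<noteq> []" using assms(1) by simp
    show "grassmann_graded.admissible (\<lambda>v. grassmann_scale (c v) (\<phi> v :: 'a grassmann))"
      if "grassmann_graded.admissible \<phi>" for \<phi> c
      using that by (rule E_inf_admissible_scale)
    fix N
    define u :: "graded_var \<Rightarrow> 'a grassmann" where
      \<comment> \<open>The variables are numbered from 1, the blocks from 0.\<close>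
      "u v = (case v of Y i \<Rightarrow> 1 | Z i \<Rightarrow> block_sum N (i - 1))" for v
    have "grassmann_graded.admissible u"
      by (simp add: grassmann_graded.admissible_def u_def one_E_inf_component block_sum_E_inf_component)
    moreover have "u v * u w = u w * u v" for v w
      by (cases v; cases w) (simp_all add: u_def block_sum_commute)
    moreover have "prod_list (map (\<lambda>v. u v ^ N) ?vs) \<noteq> 0"
    proof -
      have "map (\<lambda>v. u v ^ N) ?vs = map (\<lambda>_. 1) [1..<Suc m] @ map (\<lambda>i. block_sum N i ^ N) [0..<m]"
        by (rule nth_equalityI) (auto simp: u_def nth_append simp del: upt_Suc)
      then show ?thesis
        using prod_block_sum_power_nonzero[OF assms(2), of N m] by (simp add: map_replicate_const prod_list_replicate del: upt_Suc)
    qed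
    ultimately show "\<exists>u :: graded_var \<Rightarrow> 'a grassmann. grassmann_graded.admissible u \<and>
        (\<forall>v\<in>set ?vs. \<forall>w\<in>set ?vs. u v * u w = u w * u v) \<and> prod_list (map (\<lambda>v. u v ^ N) ?vs) \<noteq> 0"
      by blast
  qed
  moreover have "length ?vs = 2 * m" by simp
  ultimately show "ereal (real (2 * m)) \<le> graded_GKdim (grassmann_scale :: 'a \<Rightarrow> _) E_inf_component m"
    by (simp only:)
qed

lemma graded_GKdim_E_inf_char_p:
  assumes "m \<ge> 1" and "CHAR('a::field) = p" and "p > 2" and inf: "infinite (UNIV :: 'a set)"
  shows "graded_GKdim (grassmann_scale :: 'a \<Rightarrow> _) E_inf_component m = ereal (real m)"
proof (rule antisym)
  have two: "(2 :: 'a) \<noteq> 0"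
    using of_nat_eq_0_iff_char_dvd[of 2, where 'a = 'a] assms(2,3) by (auto dest: dvd_imp_le)
  have S: "Y ` {1..m} \<subseteq> graded_vars m" "card (Y ` {1..m}) = m"
    by (auto simp: graded_vars_def card_image inj_on_def)
  have nil: "a ^ p = 0" if "v \<in> graded_vars m - Y ` {1..m}" "a \<in> even_part (var_degree v)"
    for v and a :: "'a grassmann"
    using that even_part_nilpotent[OF assms(2,3)] by (auto simp: graded_vars_def)
  obtain C where C: "C > 0"
    "\<And>n. \<exists>T. finite T \<and> card T \<le> C * (n + 1) ^ card (Y ` {1..m}) \<and>
      (\<forall>ws. set ws \<subseteq> graded_vars m \<and> length ws \<le> n \<longrightarrow>
        prod_list (map grassmann_graded.generic ws) \<in> grassmann_graded.fun_alg.span (T :: ((graded_var \<Rightarrow> 'a grassmann) \<Rightarrow> 'a grassmann) set))"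
  proof (rule E_inf_growth[OF two S(1)])
    show "p > 0" using assms(3) by simp
  qed (rule nil, assumption+, rule that)
  show "graded_GKdim (grassmann_scale :: 'a \<Rightarrow> _) E_inf_component m \<le> ereal (real m)"
    using grassmann_graded.graded_GKdim_le[OF C] by (simp only: S(2))
  let ?vs = "map Y [1..<Suc m]"
  have "ereal (real (length ?vs)) \<le> graded_GKdim (grassmann_scale :: 'a \<Rightarrow> _) E_inf_component m"
  proof (rule grassmann_graded.graded_GKdim_ge[OF inf C(2)])
    show "distinct ?vs" by (auto simp: distinct_map inj_on_def)
    show "set ?vs \<subseteq> graded_vars m" by (auto simp: graded_vars_def)
    show "?vs \<noteq> []" using assms(1) by simp
    show "grassmann_graded.admissible (\<lambda>v. grassmann_scale (c v) (\<phi> v :: 'a grassmann))"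
      if "grassmann_graded.admissible \<phi>" for \<phi> c
      using that by (rule E_inf_admissible_scale)
    fix N
    define u :: "graded_var \<Rightarrow> 'a grassmann" where "u v = (case v of Y i \<Rightarrow> 1 | Z i \<Rightarrow> 0)" for v
    have "grassmann_graded.admissible u"
      by (simp add: grassmann_graded.admissible_def u_def one_E_inf_component grassmann_graded.zero_homogeneous)
    moreover have "u v * u w = u w * u v" for v w
      by (cases v; cases w) (simp_all add: u_def)
    moreover have "prod_list (map (\<lambda>v. u v ^ N) ?vs) = 1"
      by (simp add: u_def comp_def map_replicate_const prod_list_replicate del: upt_Suc)
    ultimately show "\<exists>u :: graded_var \<Rightarrow> 'a grassmann. grassmann_graded.admissible u \<and>
        (\<forall>v\<in>set ?vs. \<forall>w\<in>set ?vs. u v * u w = u w * u v) \<and> prod_list (map (\<lambda>v. u v ^ N) ?vs) \<noteq> 0"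
      using one_neq_zero by metis
  qed
  then show "ereal (real m) \<le> graded_GKdim (grassmann_scale :: 'a \<Rightarrow> _) E_inf_component m"
    by (simp del: upt_Suc)
qed

theorem theorem5p2:
  fixes p m :: nat
  assumes "prime p" and "p > 2" and "m \<ge> 1"
    and "infinite (UNIV :: 'a::field set)"
    and "CHAR('a) = 0 \<or> CHAR('a) = p"
  shows "(CHAR('a) = 0 \<longrightarrow>
      graded_GKdim (grassmann_scale :: 'a \<Rightarrow> _) E_inf_component m = ereal (real (2 * m))) \<and>
    (CHAR('a) = p \<longrightarrow>
      graded_GKdim (grassmann_scale :: 'a \<Rightarrow> _) E_inf_component m = ereal (real m))"
  using graded_GKdim_E_inf_char_0[OF assms(3) _ assms(4)]
    graded_GKdim_E_inf_char_p[OF assms(3) _ assms(2,4)] by blast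

end
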